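(* Let $n\ge 2$, let $S\in C^1(\mathbb R^n\times\mathcal S^{n\times n})$ be such that the matrix $\left(-\frac{\partial S}{\partial M_{ij}}(p,M)\right)$ is positive definite for all $(p,M)\in\mathbb R^n\times\mathcal S^{n\times n}$, and let $T\in C^1(\mathbb R_+\times\mathbb R^n\times\mathcal S^{n\times n})$ satisfy one of the following: (i) $T(t,p,M):=S(p,M)$; (ii) the matrix $\left(-\frac{\partial T}{\partial M_{ij}}\right)$ is positive definite on $\mathbb R_+\times\mathbb R^n\times\mathcal S^{n\times n}$, and there exists $\epsilon>0$ such that $$\operatorname{sign}T(\lambda t,\lambda p,\lambda M)=\operatorname{sign}T(t,p,M),\qquad\forall(\lambda,t,p,M)\in(1-\epsilon,1+\epsilon)\times\mathbb R_+\times\mathbb R^n\times\mathcal S^{n\times n};$$ (iii) $T(t,p,M):=S\left(\frac{1}{t+1}p,\frac{1}{t+1}M\right)$, $(t,p,M)\in\mathbb R_+\times\mathbb R^n\times\mathcal S^{n\times n}$. Assume that $u\in C^2(B_2\setminus\{0\})$ and $v\in C^2(B_2)$ satisfy $$v>0\ \text{ in } B_2,\qquad u>v\ \text{ in } B_2\setminus\{0\},\qquad \Delta u\le 0\ \text{ in } B_2\setminus\{0\},$$ $$T(u,\nabla u,\nabla^2u)\ge 0\ge T(v,\nabla v,\nabla^2v)\qquad\text{in } B_2\setminus\{0\}.$$ Then $$\liminf_{|x|\to 0}[u(x)-v(x)]>0 .$$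
   Context: $\mathbb R_+=(0,\infty)$; $\mathcal S^{n\times n}$ is the set of real symmetric $n\times n$ matrices; $B_a\subset\mathbb R^n$ is the ball of radius $a$ centered at the origin. *)

theory Defs
  imports "HOL-Analysis.Analysis"
begin

definition sym_mats :: "(real^'n^'n) set" where
  "sym_mats = {M. transpose M = M}"

definition sym_part :: "real^'n^'n \<Rightarrow> real^'n^'n" where
  "sym_part A = (1/2) *\<^sub>R (A + transpose A)"

definition pos_def :: "real^'n^'n \<Rightarrow> bool" where
  "pos_def A \<longleftrightarrow> transpose A = A \<and> (\<forall>x. x \<noteq> 0 \<longrightarrow> 0 < x \<bullet> (A *v x))"

text \<open>The derivative is taken within \<open>X\<close>. For open \<open>X\<close> this is the usual class
  \<open>C\<^sup>1(X)\<close>. It is also used for \<open>X = W \<times> sym_mats\<close> with \<open>W\<close> open,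
  a relatively open subset of a linear subspace; there the derivative is determined only
  along that subspace, and values of \<open>f\<close> outside \<open>X\<close> play no role.\<close>

definition C1_on :: "('a::real_normed_vector \<Rightarrow> real) \<Rightarrow> 'a set \<Rightarrow> bool" where
  "C1_on f X \<longleftrightarrow> (\<exists>f' :: 'a \<Rightarrow> 'a \<Rightarrow>\<^sub>L real.
     (\<forall>x\<in>X. (f has_derivative blinfun_apply (f' x)) (at x within X)) \<and> continuous_on X f')"

definition partial_deriv :: "'n \<Rightarrow> (real^'n \<Rightarrow> real) \<Rightarrow> real^'n \<Rightarrow> real" where
  "partial_deriv i f x = deriv (\<lambda>s. f (x + s *\<^sub>R axis i 1)) 0"

definition gradient :: "(real^'n \<Rightarrow> real) \<Rightarrow> real^'n \<Rightarrow> real^'n" where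
  "gradient f x = (\<chi> i. partial_deriv i f x)"

definition hessian :: "(real^'n \<Rightarrow> real) \<Rightarrow> real^'n \<Rightarrow> real^'n^'n" where
  "hessian f x = (\<chi> i j. partial_deriv i (partial_deriv j f) x)"

definition laplacian :: "(real^'n \<Rightarrow> real) \<Rightarrow> real^'n \<Rightarrow> real" where
  "laplacian f x = (\<Sum>i\<in>UNIV. partial_deriv i (partial_deriv i f) x)"

text \<open>Intended for open \<open>U\<close>.\<close>

definition C2_on :: "(real^'n \<Rightarrow> real) \<Rightarrow> (real^'n) set \<Rightarrow> bool" where
  "C2_on f U \<longleftrightarrow> C1_on f U \<and> (\<forall>i. C1_on (partial_deriv i f) U)"

text \<open>The matrix \<open>(\<partial>F/\<partial>M\<^sub>i\<^sub>j)\<close> of a function \<open>F\<close> of a symmetric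
  matrix, with the usual convention for fully nonlinear equations: \<open>F\<close> is extended to all
  matrices by \<open>A \<mapsto> F ((A + A\<^sup>T)/2)\<close> and the \<open>n\<^sup>2\<close> entries are treated as
  independent variables. This matrix is symmetric and represents the differential,
  \<open>dF(H) = (\<Sum>i j. \<partial>F/\<partial>M\<^sub>i\<^sub>j H\<^sub>i\<^sub>j)\<close> for symmetric \<open>H\<close>;
  in particular off-diagonal entries are not counted twice. See \<open>matrix_deriv_unique\<close>.\<close>

definition matrix_deriv :: "(real^'n^'n \<Rightarrow> real) \<Rightarrow> real^'n^'n \<Rightarrow> real^'n^'n" where
  "matrix_deriv F M =
     (\<chi> i j. deriv (\<lambda>s. F (sym_part (M + s *\<^sub>R axis i (axis j 1)))) 0)"

lemma sym_part_mem: "sym_part A \<in> sym_mats"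
  by (simp add: sym_part_def sym_mats_def vec_eq_iff transpose_def add.commute)

lemma matrix_deriv_unique:
  fixes F :: "real^'n^'n \<Rightarrow> real"
  assumes M: "M \<in> sym_mats" and G: "G \<in> sym_mats"
    and F: "(F has_derivative (\<lambda>H. \<Sum>i\<in>UNIV. \<Sum>j\<in>UNIV. G$i$j * H$i$j)) (at M within sym_mats)"
  shows "matrix_deriv F M = G"
proof -
  have F': "(F has_derivative (\<lambda>H. G \<bullet> H)) (at M within sym_mats)"
    using F by (simp add: inner_vec_def)
  have inner_axis2: "A \<bullet> axis i (axis j 1) = A$i$j" for A :: "real^'n^'n" and i j
    by (simp add: inner_axis)
  have "deriv (\<lambda>s. F (sym_part (M + s *\<^sub>R axis i (axis j 1)))) 0 = G$i$j" for i j
  proof -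
    let ?E = "axis i (axis j 1) :: real^'n^'n"
    let ?g = "\<lambda>s::real. M + s *\<^sub>R sym_part ?E"
    have eq: "sym_part (M + s *\<^sub>R ?E) = ?g s" for s
      using M by (simp add: sym_part_def sym_mats_def vec_eq_iff transpose_def field_simps)
    have GE: "G \<bullet> sym_part ?E = G$i$j"
    proof -
      have "transpose ?E = axis j (axis i 1)"
        by (auto simp: vec_eq_iff transpose_def axis_def)
      then have "G \<bullet> sym_part ?E = (G$i$j + G$j$i) / 2"
        by (simp add: sym_part_def inner_add_right inner_axis2)
      also have "G$j$i = G$i$j"
        using G by (auto simp: sym_mats_def transpose_def vec_eq_iff)
      finally show ?thesis by simp
    qed
    have g: "(?g has_derivative (\<lambda>s. s *\<^sub>R sym_part ?E)) (at 0 within UNIV)"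
      by (auto intro!: derivative_eq_intros)
    have rng: "range ?g \<subseteq> sym_mats"
      using sym_part_mem unfolding eq[symmetric] by auto
    have F0: "(F has_derivative (\<lambda>H. G \<bullet> H)) (at (?g 0) within range ?g)"
      using has_derivative_subset[OF F' rng] by simp
    have "((F \<circ> ?g) has_derivative ((\<lambda>H. G \<bullet> H) \<circ> (\<lambda>s. s *\<^sub>R sym_part ?E))) (at 0 within UNIV)"
      by (rule diff_chain_within[OF g F0])
    moreover have "(\<lambda>H. G \<bullet> H) \<circ> (\<lambda>s. s *\<^sub>R sym_part ?E) = (*) (G$i$j)"
      by (auto simp: GE)
    ultimately have "((\<lambda>s. F (?g s)) has_field_derivative G$i$j) (at 0)"
      by (simp add: has_field_derivative_def o_def)
    then show ?thesis unfolding eq by (rule DERIV_imp_deriv)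
  qed
  then show ?thesis by (simp add: matrix_deriv_def vec_eq_iff)
qed

end

theory Submission
  imports Defs
begin

text \<open>
  Each of the three structural alternatives makes \<open>T\<close> elliptic, that is, strictly
  decreasing in the symmetric matrix argument (\<open>elliptic_of_cases\<close>). Ellipticity of \<open>T\<close>
  and superharmonicity of \<open>u\<close> then give two complementary statements.

  \<^item> \<open>u\<close> lies above a cone with vertex on the graph of \<open>v\<close>: there is \<open>e > 0\<close>
  with \<open>u(x) \<ge> v(x) + e |x|\<close> near \<open>0\<close> (\<open>cone_below_solution\<close>). Otherwise, for
  given small \<open>\<delta>\<close> and \<open>r\<close>, some \<open>\<xi>\<close> with \<open>|\<xi>| = \<delta> r\<close> makes
  \<open>u - v - \<delta>|x|\<^sup>2 - \<xi> \<bullet> x\<close> negative somewhere in the punctured ball of radius \<open>r\<close>.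
  This function is nonnegative on the sphere and has nonnegative lower limit at \<open>0\<close>, because
  \<open>u > v\<close>, so its minimum is attained at a regular point \<open>x \<noteq> 0\<close>. There
  \<open>D\<^sup>2u \<ge> D\<^sup>2v + 2\<delta> I\<close>, while the values and the gradients of \<open>u\<close> and \<open>v\<close>
  differ only by \<open>O(\<delta> r)\<close>. For \<open>r\<close> small, ellipticity makes the gain \<open>2\<delta> I\<close> in the
  Hessian outweigh the change in the lower order arguments, whence
  \<open>T(u, Du, D\<^sup>2u) < T(v, Dv, D\<^sup>2v)\<close> at \<open>x\<close> (\<open>elliptic_strict_contact\<close>),
  contrary to the hypotheses.

  \<^item> A superharmonic function cannot rest on the vertex of a convex cone. On a small sphere of
  radius \<open>s\<close>, \<open>u\<close> exceeds the tangent plane of \<open>v\<close> at \<open>0\<close> by a fixed multiple of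
  \<open>e s\<close>, and the maximum principle carries this bound into the punctured ball
  (\<open>superharmonic_ge_affine\<close>): an isolated point is removable for superharmonic functions that
  are bounded below, because \<open>- ln |x|\<close> is superharmonic in dimension at least two and
  tends to infinity at \<open>0\<close>. Hence \<open>u - v\<close> has a positive lower bound near \<open>0\<close>
  (\<open>superharmonic_above_cone\<close>).
\<close>

section \<open>Twice continuously differentiable functions\<close>

lemma C1_on_open_imp:
  fixes f :: "real^'n \<Rightarrow> real"
  assumes f: "C1_on f U" and U: "open U"
  shows C1_on_has_derivative: "x \<in> U \<Longrightarrow> (f has_derivative (\<lambda>h. gradient f x \<bullet> h)) (at x)"
    and C1_on_continuous_gradient: "continuous_on U (gradient f)"
proof -
  obtain f' :: "real^'n \<Rightarrow> (real^'n) \<Rightarrow>\<^sub>L real" where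
    d: "\<And>x. x \<in> U \<Longrightarrow> (f has_derivative f' x) (at x)" and c: "continuous_on U f'"
    using f at_within_open[OF _ U] unfolding C1_on_def by metis
  have p: "gradient f x $ i = f' x (axis i 1)" if "x \<in> U" for x i
  proof -
    have "((\<lambda>s::real. x + s *\<^sub>R axis i 1) has_derivative (\<lambda>s. s *\<^sub>R axis i 1)) (at 0)"
      by (auto intro!: derivative_eq_intros)
    from diff_chain_at[OF this, of f "f' x"] d[OF that]
    have "((\<lambda>s. f (x + s *\<^sub>R axis i 1)) has_derivative (\<lambda>s. f' x (s *\<^sub>R axis i 1))) (at 0)"
      by (simp add: o_def)
    moreover have "(\<lambda>s. f' x (s *\<^sub>R axis i 1)) = (*) (f' x (axis i 1))"
      by (simp add: fun_eq_iff blinfun.scaleR_right)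
    ultimately have "((\<lambda>s. f (x + s *\<^sub>R axis i 1)) has_field_derivative f' x (axis i 1)) (at 0)"
      by (simp add: has_field_derivative_def)
    then show ?thesis by (simp add: gradient_def partial_deriv_def DERIV_imp_deriv)
  qed
  have "f' x h = gradient f x \<bullet> h" if "x \<in> U" for x h
  proof -
    have "f' x h = f' x (\<Sum>i\<in>UNIV. h $ i *\<^sub>R axis i 1)"
      by (simp only: basis_expansion[of h, unfolded scalar_mult_eq_scaleR])
    also have "\<dots> = gradient f x \<bullet> h"
      by (simp add: blinfun.sum_right blinfun.scaleR_right inner_vec_def p[OF that] mult.commute)
    finally show ?thesis .
  qed
  then have "blinfun_apply (f' x) = (\<lambda>h. gradient f x \<bullet> h)" if "x \<in> U" for x
    using that by (intro ext)
  then show "x \<in> U \<Longrightarrow> (f has_derivative (\<lambda>h. gradient f x \<bullet> h)) (at x)" using d by metis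
  have "continuous_on U (\<lambda>x. \<chi> i. f' x (axis i 1))"
    by (intro continuous_intros continuous_on_vec_lambda c)
  then show "continuous_on U (gradient f)"
    by (rule continuous_on_eq) (simp add: vec_eq_iff p)
qed

lemma C2_on_continuous_hessian:
  assumes f: "C2_on f U" and U: "open U"
  shows "continuous_on U (hessian f)"
proof -
  have "continuous_on U (\<lambda>x. \<chi> i j. gradient (partial_deriv j f) x $ i)"
    using f unfolding C2_on_def
    by (intro continuous_on_vec_lambda continuous_on_component C1_on_continuous_gradient U) auto
  moreover have "(\<lambda>x. \<chi> i j. gradient (partial_deriv j f) x $ i) = hessian f"
    by (simp add: hessian_def gradient_def fun_eq_iff)
  ultimately show ?thesis by (simp only:)
qed

lemma C2_on_imp_continuous_on:
  fixes f :: "real^'n \<Rightarrow> real"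
  assumes "C2_on f U" "open U"
  shows "continuous_on U f"
  using assms C1_on_has_derivative has_derivative_continuous
  unfolding C2_on_def by (intro continuous_at_imp_continuous_on) blast

lemma C2_on_subset: "C2_on f U \<Longrightarrow> V \<subseteq> U \<Longrightarrow> C2_on f V"
  unfolding C2_on_def C1_on_def by (meson continuous_on_subset has_derivative_subset subsetD)

lemma has_field_derivative_line:
  fixes f :: "real^'n \<Rightarrow> real"
  assumes "(f has_derivative (\<lambda>h. g \<bullet> h)) (at (x + s *\<^sub>R y))"
  shows "((\<lambda>s. f (x + s *\<^sub>R y)) has_field_derivative g \<bullet> y) (at s within A)"
proof -
  have "((\<lambda>s::real. x + s *\<^sub>R y) has_derivative (\<lambda>s. s *\<^sub>R y)) (at s)"
    by (auto intro!: derivative_eq_intros)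
  from diff_chain_at[OF this, of f "\<lambda>h. g \<bullet> h"] assms
  have "((\<lambda>s. f (x + s *\<^sub>R y)) has_derivative (\<lambda>t. t * (g \<bullet> y))) (at s)"
    by (simp add: o_def)
  moreover have "(\<lambda>t. t * (g \<bullet> y)) = (*) (g \<bullet> y)" by (simp add: fun_eq_iff)
  ultimately show ?thesis
    unfolding has_field_derivative_def by (simp only: has_derivative_at_withinI)
qed

text \<open>The second difference over a square is symmetric in the two directions, so writing it
  as a mixed derivative in either order is what yields Schwarz's theorem below.\<close>

lemma second_difference_mean_value:
  assumes f: "C2_on f U" and U: "open U" and s: "0 < s"
    and sub: "\<And>p q. \<lbrakk>0 \<le> p; p \<le> s; 0 \<le> q; q \<le> s\<rbrakk> \<Longrightarrow> x + p *\<^sub>R axis j 1 + q *\<^sub>R axis i 1 \<in> U"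
  obtains p q where "0 \<le> p" "p \<le> s" "0 \<le> q" "q \<le> s"
    "f (x + s *\<^sub>R axis j 1 + s *\<^sub>R axis i 1) - f (x + s *\<^sub>R axis j 1)
       - f (x + s *\<^sub>R axis i 1) + f x
     = s\<^sup>2 * hessian f (x + p *\<^sub>R axis j 1 + q *\<^sub>R axis i 1) $ i $ j"
proof -
  let ?a = "axis j 1" and ?b = "axis i 1"
  have C: "C1_on f U" "C1_on (partial_deriv j f) U" using f by (auto simp: C2_on_def)
  have g: "gradient f y $ k = partial_deriv k f y" for y k by (simp add: gradient_def)
  have d1: "((\<lambda>p. f (z + p *\<^sub>R ?a)) has_field_derivative partial_deriv j f (z + p *\<^sub>R ?a)) (at p)"
    if "z + p *\<^sub>R ?a \<in> U" for z p
    using has_field_derivative_line[OF C1_on_has_derivative[OF C(1) U that]]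
    by (simp add: inner_axis g)
  have d2: "((\<lambda>q. partial_deriv j f (z + q *\<^sub>R ?b)) has_field_derivative hessian f (z + q *\<^sub>R ?b) $ i $ j) (at q)"
    if "z + q *\<^sub>R ?b \<in> U" for z q
    using has_field_derivative_line[OF C1_on_has_derivative[OF C(2) U that]]
    by (simp add: inner_axis gradient_def hessian_def)
  have sub': "x + s *\<^sub>R ?b + p *\<^sub>R ?a \<in> U" "x + p *\<^sub>R ?a \<in> U" if "0 \<le> p" "p \<le> s" for p
    using sub[of p s] sub[of p 0] that s by (auto simp: algebra_simps)
  have "\<exists>p>0. p < s \<and> (f (x + s *\<^sub>R ?b + s *\<^sub>R ?a) - f (x + s *\<^sub>R ?a))
        - (f (x + s *\<^sub>R ?b + 0 *\<^sub>R ?a) - f (x + 0 *\<^sub>R ?a))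
      = (s - 0) * (partial_deriv j f (x + s *\<^sub>R ?b + p *\<^sub>R ?a) - partial_deriv j f (x + p *\<^sub>R ?a))"
    by (rule MVT2[OF s, of "\<lambda>p. f (x + s *\<^sub>R ?b + p *\<^sub>R ?a) - f (x + p *\<^sub>R ?a)"])
       (intro DERIV_diff d1 sub', auto)
  then obtain p where p: "0 < p" "p < s" and
    e1: "f (x + s *\<^sub>R ?b + s *\<^sub>R ?a) - f (x + s *\<^sub>R ?a) - f (x + s *\<^sub>R ?b) + f x
      = s * (partial_deriv j f (x + s *\<^sub>R ?b + p *\<^sub>R ?a) - partial_deriv j f (x + p *\<^sub>R ?a))"
    by auto
  have "\<exists>q>0. q < s \<and> partial_deriv j f (x + p *\<^sub>R ?a + s *\<^sub>R ?b) - partial_deriv j f (x + p *\<^sub>R ?a + 0 *\<^sub>R ?b)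
      = (s - 0) * (hessian f (x + p *\<^sub>R ?a + q *\<^sub>R ?b) $ i $ j)"
    by (rule MVT2[OF s, of "\<lambda>q. partial_deriv j f (x + p *\<^sub>R ?a + q *\<^sub>R ?b)"])
       (intro d2 sub, use p in auto)
  then obtain q where q: "0 < q" "q < s" and
    e2: "partial_deriv j f (x + p *\<^sub>R ?a + s *\<^sub>R ?b) - partial_deriv j f (x + p *\<^sub>R ?a)
      = s * (hessian f (x + p *\<^sub>R ?a + q *\<^sub>R ?b) $ i $ j)" by auto
  have c: "x + s *\<^sub>R ?b + p *\<^sub>R ?a = x + p *\<^sub>R ?a + s *\<^sub>R ?b"
    "x + s *\<^sub>R ?b + s *\<^sub>R ?a = x + s *\<^sub>R ?a + s *\<^sub>R ?b"
    by (simp_all add: algebra_simps)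
  show ?thesis
    by (rule that[of p q]) (use p q e1 e2 in \<open>auto simp: c power2_eq_square\<close>)
qed

text \<open>Schwarz's theorem. The hypotheses on \<open>T\<close> concern only symmetric matrices, so every
  use of them at a Hessian depends on this.\<close>

lemma hessian_symmetric:
  assumes f: "C2_on f U" and U: "open U" and x: "x \<in> U"
  shows "hessian f x \<in> sym_mats"
proof -
  have "hessian f x $ i $ j = hessian f x $ j $ i" for i j
  proof (rule ccontr)
    let ?H = "hessian f x"
    assume ne: "?H $ i $ j \<noteq> ?H $ j $ i"
    define e where "e = \<bar>?H $ i $ j - ?H $ j $ i\<bar> / 2"
    have e: "e > 0" using ne by (simp add: e_def)
    have lim: "\<exists>d>0. \<forall>y. dist y x < d \<longrightarrow> \<bar>hessian f y $ k $ l - ?H $ k $ l\<bar> < e" for k l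
    proof -
      have "isCont (\<lambda>y. hessian f y $ k $ l) x"
        using C2_on_continuous_hessian[OF f U] x U
        by (intro continuous_intros) (auto simp: continuous_on_eq_continuous_at)
      then show ?thesis using e
        by (auto simp: continuous_at_eps_delta dist_real_def)
    qed
    obtain d1 where d1: "d1 > 0" "\<And>y. dist y x < d1 \<Longrightarrow> \<bar>hessian f y $ i $ j - ?H $ i $ j\<bar> < e"
      using lim by blast
    obtain d2 where d2: "d2 > 0" "\<And>y. dist y x < d2 \<Longrightarrow> \<bar>hessian f y $ j $ i - ?H $ j $ i\<bar> < e"
      using lim by blast
    obtain d3 where d3: "d3 > 0" "ball x d3 \<subseteq> U" using U x openE by blast
    define s where "s = min d1 (min d2 d3) / 3"
    have s: "s > 0" "2 * s < d1" "2 * s < d2" "2 * s < d3" using d1 d2 d3 by (auto simp: s_def)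
    have close: "dist (x + p *\<^sub>R axis k 1 + q *\<^sub>R axis l 1) x \<le> 2 * s"
      if "0 \<le> p" "p \<le> s" "0 \<le> q" "q \<le> s" for p q k l
      using norm_triangle_ineq[of "p *\<^sub>R axis k (1::real)" "q *\<^sub>R axis l 1"] that
      by (simp add: dist_norm)
    have inU: "x + p *\<^sub>R axis k 1 + q *\<^sub>R axis l 1 \<in> U"
      if "0 \<le> p" "p \<le> s" "0 \<le> q" "q \<le> s" for p q k l
      using close[OF that, of k l] s(4) d3(2) by (auto simp: dist_commute subset_iff)
    obtain p q where pq: "0 \<le> p" "p \<le> s" "0 \<le> q" "q \<le> s" and
      1: "f (x + s *\<^sub>R axis j 1 + s *\<^sub>R axis i 1) - f (x + s *\<^sub>R axis j 1)
       - f (x + s *\<^sub>R axis i 1) + f x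
     = s\<^sup>2 * hessian f (x + p *\<^sub>R axis j 1 + q *\<^sub>R axis i 1) $ i $ j"
      by (rule second_difference_mean_value[OF f U s(1), of x j i]) (use inU in auto)
    obtain p' q' where pq': "0 \<le> p'" "p' \<le> s" "0 \<le> q'" "q' \<le> s" and
      2: "f (x + s *\<^sub>R axis i 1 + s *\<^sub>R axis j 1) - f (x + s *\<^sub>R axis i 1)
       - f (x + s *\<^sub>R axis j 1) + f x
     = s\<^sup>2 * hessian f (x + p' *\<^sub>R axis i 1 + q' *\<^sub>R axis j 1) $ j $ i"
      by (rule second_difference_mean_value[OF f U s(1), of x i j]) (use inU in auto)
    have "x + s *\<^sub>R axis j 1 + s *\<^sub>R axis i 1 = x + s *\<^sub>R axis i 1 + s *\<^sub>R axis j 1"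
      by (simp add: algebra_simps)
    from 1[unfolded this] 2 have "s\<^sup>2 * hessian f (x + p *\<^sub>R axis j 1 + q *\<^sub>R axis i 1) $ i $ j
       = s\<^sup>2 * hessian f (x + p' *\<^sub>R axis i 1 + q' *\<^sub>R axis j 1) $ j $ i" by linarith
    then have "hessian f (x + p *\<^sub>R axis j 1 + q *\<^sub>R axis i 1) $ i $ j
       = hessian f (x + p' *\<^sub>R axis i 1 + q' *\<^sub>R axis j 1) $ j $ i" using s(1) by simp
    moreover have "\<bar>hessian f (x + p *\<^sub>R axis j 1 + q *\<^sub>R axis i 1) $ i $ j - ?H $ i $ j\<bar> < e"
      using close[OF pq, of j i] s by (intro d1) auto
    moreover have "\<bar>hessian f (x + p' *\<^sub>R axis i 1 + q' *\<^sub>R axis j 1) $ j $ i - ?H $ j $ i\<bar> < e"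
      using close[OF pq', of i j] s by (intro d2) auto
    ultimately show False unfolding e_def by (smt (verit) field_sum_of_halves)
  qed
  then show ?thesis by (simp add: sym_mats_def transpose_def vec_eq_iff)
qed

lemma gradient_line_derivative:
  assumes f: "C2_on f U" and U: "open U" and x: "x \<in> U"
  shows "((\<lambda>s. gradient f (x + s *\<^sub>R y) \<bullet> y) has_field_derivative y \<bullet> (hessian f x *v y)) (at 0)"
proof -
  have "((\<lambda>s. partial_deriv j f (x + s *\<^sub>R y)) has_field_derivative gradient (partial_deriv j f) x \<bullet> y) (at 0)" for j
    using f x C1_on_has_derivative[OF _ U, of "partial_deriv j f" x]
    by (intro has_field_derivative_line) (auto simp: C2_on_def)
  then have "((\<lambda>s. \<Sum>j\<in>UNIV. partial_deriv j f (x + s *\<^sub>R y) * y $ j) has_field_derivative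
     (\<Sum>j\<in>UNIV. (gradient (partial_deriv j f) x \<bullet> y) * y $ j)) (at 0)"
    by (intro DERIV_sum DERIV_cmult_right)
  moreover have "(\<Sum>j\<in>UNIV. (gradient (partial_deriv j f) x \<bullet> y) * y $ j) = y \<bullet> (hessian f x *v y)"
  proof -
    have "(\<Sum>j\<in>UNIV. (gradient (partial_deriv j f) x \<bullet> y) * y $ j)
       = (\<Sum>j\<in>UNIV. \<Sum>i\<in>UNIV. hessian f x $ i $ j * y $ i * y $ j)"
      by (simp add: inner_vec_def gradient_def hessian_def sum_distrib_right)
    also have "\<dots> = (\<Sum>i\<in>UNIV. \<Sum>j\<in>UNIV. hessian f x $ i $ j * y $ i * y $ j)"
      by (rule sum.swap)
    also have "\<dots> = y \<bullet> (hessian f x *v y)"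
      by (simp add: inner_vec_def matrix_vector_mult_def sum_distrib_left mult_ac)
    finally show ?thesis .
  qed
  ultimately show ?thesis by (simp add: inner_vec_def gradient_def)
qed

lemma local_min_second_derivative:
  fixes g :: "real \<Rightarrow> real"
  assumes d: "0 < d" and min: "\<And>s. \<bar>s\<bar> < d \<Longrightarrow> g 0 \<le> g s"
    and g: "\<And>s. \<bar>s\<bar> < d \<Longrightarrow> (g has_field_derivative g' s) (at s)"
    and g': "(g' has_field_derivative k) (at 0)"
  shows "g' 0 = 0" "0 \<le> k"
proof -
  show 0: "g' 0 = 0"
    by (rule DERIV_local_min[OF g d]) (use d min in auto)
  show "0 \<le> k"
  proof (rule ccontr)
    assume "\<not> 0 \<le> k"
    then obtain e where e: "e > 0" "\<And>h. \<lbrakk>0 < h; h < e\<rbrakk> \<Longrightarrow> g' 0 > g' (0 + h)"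
      using DERIV_neg_dec_right[OF g'] by auto
    define s where "s = min d e / 2"
    have s: "0 < s" "s < d" "s < e" using d e by (auto simp: s_def)
    have "\<exists>z>0. z < s \<and> g s - g 0 = (s - 0) * g' z"
      by (rule MVT2[OF s(1)]) (use s in \<open>auto intro!: g\<close>)
    then obtain z where z: "0 < z" "z < s" "g s - g 0 = s * g' z" by auto
    then have "g' z < 0" using e(2)[of z] s 0 by auto
    then have "s * g' z < 0" using s(1) by (simp add: mult_pos_neg)
    then show False using z min[of s] s by auto
  qed
qed

lemma line_in_open:
  fixes x y :: "'a::real_normed_vector"
  assumes U: "open U" and x: "x \<in> U"
  obtains d :: real where "d > 0" "\<And>s. \<bar>s\<bar> < d \<Longrightarrow> x + s *\<^sub>R y \<in> U"
proof -
  have "isCont (\<lambda>s::real. x + s *\<^sub>R y) 0" by (intro continuous_intros)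
  then have "((\<lambda>s::real. x + s *\<^sub>R y) \<longlongrightarrow> x) (at 0)" by (simp add: isCont_def)
  then have "eventually (\<lambda>s::real. x + s *\<^sub>R y \<in> U) (at 0)"
    using U x by (rule topological_tendstoD)
  then obtain e where e: "e > 0" "\<And>s::real. s \<noteq> 0 \<Longrightarrow> \<bar>s\<bar> < e \<Longrightarrow> x + s *\<^sub>R y \<in> U"
    by (auto simp: eventually_at dist_real_def)
  have "x + s *\<^sub>R y \<in> U" if "\<bar>s\<bar> < e" for s
    using e(2)[of s] x that by (cases "s = 0") auto
  with e(1) show ?thesis by (rule that)
qed

text \<open>The test function \<open>g\<close> enters only through its restriction to one line, so that the
  same lemma serves for the logarithmic barrier and for perturbations of a \<open>C\<^sup>2\<close>
  function.\<close>

lemma touching_from_below: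
  assumes f: "C2_on f U" and U: "open U" and x: "x \<in> U"
    and min: "\<And>y. y \<in> U \<Longrightarrow> f x - g x \<le> f y - g y"
    and d: "0 < d"
    and g: "\<And>s. \<bar>s\<bar> < d \<Longrightarrow> ((\<lambda>s. g (x + s *\<^sub>R y)) has_field_derivative g' s) (at s)"
    and g': "(g' has_field_derivative k) (at 0)"
  shows "gradient f x \<bullet> y = g' 0" "k \<le> y \<bullet> (hessian f x *v y)"
proof -
  obtain e where e: "e > 0" and inU: "\<And>s. \<bar>s\<bar> < e \<Longrightarrow> x + s *\<^sub>R y \<in> U"
    using line_in_open[OF U x] by blast
  have C: "C1_on f U" using f by (simp add: C2_on_def)
  let ?g = "\<lambda>s. f (x + s *\<^sub>R y) - g (x + s *\<^sub>R y)"
  have D: "(?g has_field_derivative (gradient f (x + s *\<^sub>R y) \<bullet> y - g' s)) (at s)"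
    if "\<bar>s\<bar> < min d e" for s
    using that inU[of s]
    by (intro DERIV_diff has_field_derivative_line C1_on_has_derivative[OF C U] g) auto
  have "((\<lambda>s. gradient f (x + s *\<^sub>R y) \<bullet> y - g' s) has_field_derivative
      y \<bullet> (hessian f x *v y) - k) (at 0)"
    by (intro DERIV_diff gradient_line_derivative[OF f U x] g')
  note k = this
  have m: "0 < min d e" using d e by simp
  have mm: "?g 0 \<le> ?g s" if "\<bar>s\<bar> < min d e" for s
    using min[OF inU, of s] that by simp
  from local_min_second_derivative[OF m mm D k]
  show "gradient f x \<bullet> y = g' 0" "k \<le> y \<bullet> (hessian f x *v y)" by simp_all
qed

section \<open>Symmetric matrices and ellipticity\<close>

lemma quadratic_form_line:
  fixes D :: "real^'n^'n"
  assumes D: "D \<in> sym_mats"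
  shows "(x + c *\<^sub>R y) \<bullet> (D *v (x + c *\<^sub>R y))
    = x \<bullet> (D *v x) + 2 * c * (x \<bullet> (D *v y)) + c\<^sup>2 * (y \<bullet> (D *v y))"
proof -
  have t: "transpose D = D" using D by (simp add: sym_mats_def)
  have "y \<bullet> (D *v x) = (D *v y) \<bullet> x"
    using dot_lmul_matrix[of y D x] vector_transpose_matrix[of y D] unfolding t by simp
  then have "y \<bullet> (D *v x) = x \<bullet> (D *v y)" by (simp add: inner_commute)
  then show ?thesis
    by (simp add: matrix_vector_right_distrib matrix_vector_mult_scaleR inner_add_left inner_add_right
        algebra_simps power2_eq_square)
qed

lemma inner_axis_matrix_vector:
  fixes D :: "real^'n^'n"
  shows "axis i 1 \<bullet> (D *v axis j 1) = D $ i $ j"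
  by (simp add: matrix_vector_mult_basis column_def inner_axis')

lemma psd_zero_diagonal:
  fixes D :: "real^'n^'n"
  assumes D: "D \<in> sym_mats" and psd: "\<And>x. 0 \<le> x \<bullet> (D *v x)" and z: "\<And>k. D $ k $ k = 0"
  shows "D = 0"
proof -
  have "D $ i $ j = 0" for i j
    using psd[of "axis i 1 + 1 *\<^sub>R axis j 1"] psd[of "axis i 1 + (-1) *\<^sub>R axis j 1"]
    by (simp only: quadratic_form_line[OF D] inner_axis_matrix_vector z)
  then show ?thesis by (simp add: vec_eq_iff)
qed

text \<open>The trace of the product of two positive semidefinite matrices is nonnegative. It is clear
  when \<open>D = w w\<^sup>T\<close>, as the trace is then \<open>w \<bullet> A w\<close>. In general, one step of
  symmetric Gaussian elimination splits off such a rank one term and leaves a semidefinite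
  matrix with fewer nonzero diagonal entries.\<close>

lemma psd_inner_nonneg:
  fixes A D :: "real^'n^'n"
  assumes A: "\<And>x. 0 \<le> x \<bullet> (A *v x)"
    and D: "D \<in> sym_mats" and psd: "\<And>x. 0 \<le> x \<bullet> (D *v x)"
  shows "0 \<le> A \<bullet> D"
  using D psd
proof (induction "card {k. D $ k $ k \<noteq> 0}" arbitrary: D rule: less_induct)
  case less
  show ?case
  proof (cases "\<forall>k. D $ k $ k = 0")
    case True
    then have "D = 0" using psd_zero_diagonal[OF less.prems] by blast
    then show ?thesis by simp
  next
    case False
    then obtain k where k: "D $ k $ k \<noteq> 0" by blast
    have dpos: "0 \<le> D $ i $ i" for i
      using less.prems(2)[of "axis i 1"] by (simp add: inner_axis_matrix_vector)
    define d where "d = D $ k $ k"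
    have d: "d > 0" using dpos[of k] k by (simp add: d_def)
    have s: "D $ i $ j = D $ j $ i" for i j
      using less.prems(1) by (auto simp: sym_mats_def transpose_def vec_eq_iff)
    define w where "w = D *v axis k 1"
    have w: "w $ i = D $ i $ k" for i
      by (simp add: w_def matrix_vector_mult_basis column_def)
    have wk: "axis k 1 \<bullet> w = d" by (simp add: w_def inner_axis_matrix_vector d_def)
    define W where "W = (\<chi> i j. w $ i * w $ j)"
    define D' where "D' = D - (1 / d) *\<^sub>R W"
    have D'_comp: "D' $ i $ j = D $ i $ j - D $ i $ k * D $ j $ k / d" for i j
      by (simp add: D'_def W_def w)
    have D': "D' \<in> sym_mats"
      by (simp add: sym_mats_def transpose_def vec_eq_iff D'_comp s mult.commute)
    have W: "x \<bullet> (W *v x) = (x \<bullet> w)\<^sup>2" for x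
      by (simp add: W_def inner_vec_def matrix_vector_mult_def power2_eq_square sum_product
          sum_distrib_left sum_distrib_right mult_ac)
    have psd': "0 \<le> x \<bullet> (D' *v x)" for x
    proof -
      have "x \<bullet> (D' *v x) = x \<bullet> (D *v x) - (x \<bullet> w)\<^sup>2 / d"
        by (simp add: D'_def matrix_vector_mult_diff_rdistrib scaleR_matrix_vector_assoc[symmetric]
            inner_diff_right W)
      \<comment> \<open>completing the square: the value of the form for \<open>D'\<close> at \<open>x\<close> is that for \<open>D\<close> at the minimum over \<open>x + \<real> e\<^sub>k\<close>\<close>
      also have "\<dots> = (x + (- (x \<bullet> w) / d) *\<^sub>R axis k 1) \<bullet> (D *v (x + (- (x \<bullet> w) / d) *\<^sub>R axis k 1))"
        using d unfolding quadratic_form_line[OF less.prems(1)]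
        by (simp add: w_def[symmetric] wk power2_eq_square field_simps)
      also have "\<dots> \<ge> 0" by (rule less.prems(2))
      finally show ?thesis .
    qed
    have "{i. D' $ i $ i \<noteq> 0} \<subset> {i. D $ i $ i \<noteq> 0}"
    proof
      show "{i. D' $ i $ i \<noteq> 0} \<subseteq> {i. D $ i $ i \<noteq> 0}"
      proof clarify
        fix i assume i: "D' $ i $ i \<noteq> 0" "D $ i $ i = 0"
        have "0 \<le> D' $ i $ i" using psd'[of "axis i 1"] by (simp add: inner_axis_matrix_vector)
        moreover have "D' $ i $ i \<le> 0" using d i(2) by (simp add: D'_comp)
        ultimately show False using i(1) by simp
      qed
      have "D' $ k $ k = 0" using d by (simp add: D'_comp d_def)
      then show "{i. D' $ i $ i \<noteq> 0} \<noteq> {i. D $ i $ i \<noteq> 0}" using k by blast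
    qed
    then have "card {i. D' $ i $ i \<noteq> 0} < card {i. D $ i $ i \<noteq> 0}"
      by (intro psubset_card_mono) auto
    then have "0 \<le> A \<bullet> D'" using less.hyps D' psd' by blast
    moreover have "A \<bullet> W = w \<bullet> (A *v w)"
      by (simp add: W_def inner_vec_def matrix_vector_mult_def sum_distrib_left mult_ac)
    moreover have "A \<bullet> D = A \<bullet> D' + (1 / d) * (A \<bullet> W)"
      by (simp add: D'_def inner_diff_right)
    ultimately show ?thesis using A[of w] d by simp
  qed
qed

lemma sym_part_of_sym: "M \<in> sym_mats \<Longrightarrow> sym_part M = M"
  by (simp add: sym_part_def sym_mats_def scaleR_2[symmetric])

lemma bounded_linear_sym_part: "bounded_linear sym_part"
proof -
  have "linear (transpose :: real^'n^'n \<Rightarrow> real^'n^'n)"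
    by (auto simp: linear_iff transpose_def vec_eq_iff)
  then have "bounded_linear (transpose :: real^'n^'n \<Rightarrow> real^'n^'n)"
    by (simp add: linear_conv_bounded_linear)
  then have "bounded_linear (\<lambda>A :: real^'n^'n. (1/2) *\<^sub>R (A + transpose A))"
    by (intro bounded_linear_const_scaleR bounded_linear_add bounded_linear_ident)
  then show ?thesis by (simp add: sym_part_def[abs_def])
qed

text \<open>The derivative within the symmetric matrices is determined only on symmetric directions;
  symmetrizing the unit matrix in the direction \<open>(i, j)\<close> keeps the curve in that
  subspace.\<close>

lemma matrix_deriv_component:
  fixes F :: "real^'n^'n \<Rightarrow> real"
  assumes M: "M \<in> sym_mats" and F: "(F has_derivative D) (at M within sym_mats)"
  shows "matrix_deriv F M $ i $ j = D (sym_part (axis i (axis j 1)))"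
proof -
  let ?E = "axis i (axis j 1) :: real^'n^'n"
  let ?g = "\<lambda>s::real. M + s *\<^sub>R sym_part ?E"
  interpret D: bounded_linear D by (rule has_derivative_bounded_linear[OF F])
  interpret sp: bounded_linear "sym_part :: real^'n^'n \<Rightarrow> _" by (rule bounded_linear_sym_part)
  have eq: "sym_part (M + s *\<^sub>R ?E) = ?g s" for s
    by (simp add: sp.add sp.scaleR sym_part_of_sym M)
  have g: "(?g has_derivative (\<lambda>s. s *\<^sub>R sym_part ?E)) (at 0 within UNIV)"
    by (auto intro!: derivative_eq_intros)
  have rng: "range ?g \<subseteq> sym_mats"
    using sym_part_mem unfolding eq[symmetric] by auto
  have F0: "(F has_derivative D) (at (?g 0) within range ?g)"
    using has_derivative_subset[OF F rng] by simp
  have "((F \<circ> ?g) has_derivative (D \<circ> (\<lambda>s. s *\<^sub>R sym_part ?E))) (at 0 within UNIV)"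
    by (rule diff_chain_within[OF g F0])
  moreover have "D \<circ> (\<lambda>s. s *\<^sub>R sym_part ?E) = (*) (D (sym_part ?E))"
    by (auto simp: D.scaleR)
  ultimately have "((\<lambda>s. F (?g s)) has_field_derivative D (sym_part ?E)) (at 0)"
    by (simp add: has_field_derivative_def o_def)
  then show ?thesis by (simp add: matrix_deriv_def eq DERIV_imp_deriv)
qed

lemma matrix_basis_expansion:
  fixes H :: "real^'n^'n"
  shows "H = (\<Sum>i\<in>UNIV. \<Sum>j\<in>UNIV. H $ i $ j *\<^sub>R axis i (axis j 1))"
proof -
  have "(\<Sum>i\<in>UNIV. \<Sum>j\<in>UNIV. (H $ i $ j *\<^sub>R axis i (axis j 1) :: real^'n^'n) $ k $ l) = H $ k $ l" for k l
  proof -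
    have "(H $ i $ j *\<^sub>R axis i (axis j 1) :: real^'n^'n) $ k $ l
        = (if j = l then if i = k then H $ i $ l else 0 else 0)" for i j
      by (auto simp: axis_def)
    then show ?thesis by (simp only: sum.delta finite UNIV_I if_True)
  qed
  then show ?thesis by (simp add: vec_eq_iff)
qed

lemma matrix_deriv_inner:
  fixes F :: "real^'n^'n \<Rightarrow> real"
  assumes M: "M \<in> sym_mats" and H: "H \<in> sym_mats"
    and F: "(F has_derivative D) (at M within sym_mats)"
  shows "D H = matrix_deriv F M \<bullet> H"
proof -
  interpret D: bounded_linear D by (rule has_derivative_bounded_linear[OF F])
  interpret sp: bounded_linear "sym_part :: real^'n^'n \<Rightarrow> _" by (rule bounded_linear_sym_part)
  have "D H = D (sym_part (\<Sum>i\<in>UNIV. \<Sum>j\<in>UNIV. H $ i $ j *\<^sub>R axis i (axis j 1)))"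
    by (simp only: matrix_basis_expansion[of H, symmetric] sym_part_of_sym H)
  also have "\<dots> = (\<Sum>i\<in>UNIV. \<Sum>j\<in>UNIV. H $ i $ j * matrix_deriv F M $ i $ j)"
    by (simp add: sp.sum sp.scaleR D.sum D.scaleR matrix_deriv_component[OF M F])
  also have "\<dots> = matrix_deriv F M \<bullet> H"
    by (simp add: inner_vec_def mult.commute)
  finally show ?thesis .
qed

lemma sym_mats_scaleR: "M \<in> sym_mats \<Longrightarrow> c *\<^sub>R M \<in> sym_mats"
  by (simp add: sym_mats_def transpose_def vec_eq_iff)

lemma sym_mats_add: "M \<in> sym_mats \<Longrightarrow> N \<in> sym_mats \<Longrightarrow> M + N \<in> sym_mats"
  by (simp add: sym_mats_def transpose_def vec_eq_iff)

lemma sym_mats_diff: "M \<in> sym_mats \<Longrightarrow> N \<in> sym_mats \<Longrightarrow> M - N \<in> sym_mats"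
  by (simp add: sym_mats_def transpose_def vec_eq_iff)

lemma convex_sym_mats: "convex sym_mats"
  by (auto simp: convex_def intro: sym_mats_add sym_mats_scaleR)

lemma matrix_deriv_cong:
  assumes "\<And>M. M \<in> sym_mats \<Longrightarrow> F M = G M"
  shows "matrix_deriv F = matrix_deriv G"
  by (simp add: matrix_deriv_def[abs_def] assms sym_part_mem)

lemma matrix_deriv_rescale:
  fixes F :: "real^'n^'n \<Rightarrow> real"
  assumes M: "M \<in> sym_mats"
    and F: "(F has_derivative D) (at (c *\<^sub>R M) within sym_mats)"
  shows "matrix_deriv (\<lambda>N. F (c *\<^sub>R N)) M = c *\<^sub>R matrix_deriv F (c *\<^sub>R M)"
proof -
  interpret D: bounded_linear D by (rule has_derivative_bounded_linear[OF F])
  have "((\<lambda>N. c *\<^sub>R N) has_derivative (\<lambda>N. c *\<^sub>R N)) (at M within sym_mats)"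
    by (auto intro!: derivative_eq_intros)
  moreover have "(F has_derivative D) (at (c *\<^sub>R M) within (\<lambda>N. c *\<^sub>R N) ` sym_mats)"
    by (rule has_derivative_subset[OF F]) (auto intro: sym_mats_scaleR)
  ultimately have "(F \<circ> (\<lambda>N. c *\<^sub>R N) has_derivative D \<circ> (\<lambda>N. c *\<^sub>R N)) (at M within sym_mats)"
    by (rule diff_chain_within)
  then have "((\<lambda>N. F (c *\<^sub>R N)) has_derivative (\<lambda>N. D (c *\<^sub>R N))) (at M within sym_mats)"
    by (simp add: o_def)
  from matrix_deriv_component[OF M this]
    matrix_deriv_component[OF sym_mats_scaleR[OF M] F]
  show ?thesis by (simp add: vec_eq_iff D.scaleR)
qed

lemma has_derivative_last_component:
  fixes F :: "'a::real_normed_vector \<times> 'b::real_normed_vector \<Rightarrow> 'c::real_normed_vector"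
  assumes F: "(F has_derivative F') (at (a, M) within A \<times> Y)" and a: "a \<in> A"
  shows "((\<lambda>N. F (a, N)) has_derivative (\<lambda>H. F' (0, H))) (at M within Y)"
proof -
  have "((\<lambda>N. (a, N)) has_derivative (\<lambda>H. (0, H))) (at M within Y)"
    by (auto intro!: derivative_eq_intros)
  moreover have "(F has_derivative F') (at (a, M) within (\<lambda>N. (a, N)) ` Y)"
    by (rule has_derivative_subset[OF F]) (use a in auto)
  ultimately have "(F \<circ> (\<lambda>N. (a, N)) has_derivative F' \<circ> (\<lambda>H. (0, H))) (at M within Y)"
    by (rule diff_chain_within)
  then show ?thesis by (simp add: o_def)
qed

lemma mean_value_within_convex:
  fixes f :: "'a::real_normed_vector \<Rightarrow> real"
  assumes X: "convex X" and P: "P \<in> X" and Q: "Q \<in> X"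
    and f: "\<And>x. x \<in> X \<Longrightarrow> (f has_derivative f' x) (at x within X)"
  obtains z where "z \<in> closed_segment P Q" "f Q - f P = f' z (Q - P)"
proof -
  let ?g = "\<lambda>s::real. P + s *\<^sub>R (Q - P)"
  have gX: "?g s \<in> X" "?g s \<in> closed_segment P Q" if "0 \<le> s" "s \<le> 1" for s
  proof -
    show "?g s \<in> closed_segment P Q"
      using that by (auto simp: in_segment algebra_simps)
    then show "?g s \<in> X" using closed_segment_subset[OF P Q X] by blast
  qed
  have D: "((\<lambda>s. f (?g s)) has_derivative (\<lambda>t. f' (?g s) (t *\<^sub>R (Q - P)))) (at s within {0..1})"
    if "0 \<le> s" "s \<le> 1" for s
  proof -
    have "(?g has_derivative (\<lambda>t. t *\<^sub>R (Q - P))) (at s within {0..1})"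
      by (auto intro!: derivative_eq_intros)
    moreover have "(f has_derivative f' (?g s)) (at (?g s) within ?g ` {0..1})"
      by (rule has_derivative_subset[OF f]) (use gX that in auto)
    ultimately have "(f \<circ> ?g has_derivative f' (?g s) \<circ> (\<lambda>t. t *\<^sub>R (Q - P))) (at s within {0..1})"
      by (rule diff_chain_within)
    then show ?thesis by (simp add: o_def)
  qed
  obtain s where s: "s \<in> {0..1}" "f (?g 1) - f (?g 0) = f' (?g s) ((1 - 0) *\<^sub>R (Q - P))"
    using mvt_very_simple[of 0 1 "\<lambda>s. f (?g s)" "\<lambda>s t. f' (?g s) (t *\<^sub>R (Q - P))"] D by force
  show ?thesis by (rule that[of "?g s"]) (use s gX in auto)
qed

definition elliptic :: "(real \<Rightarrow> real^'n \<Rightarrow> real^'n^'n \<Rightarrow> real) \<Rightarrow> bool" where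
  "elliptic T \<longleftrightarrow> (\<forall>t>0. \<forall>p. \<forall>M\<in>sym_mats. pos_def (- matrix_deriv (T t p) M))"

lemma mat_1_sym: "mat 1 \<in> sym_mats"
  by (simp add: sym_mats_def)

lemma matrix_deriv_pair:
  fixes T :: "real \<Rightarrow> real^'n \<Rightarrow> real^'n^'n \<Rightarrow> real"
  assumes T: "((\<lambda>(t, p, M). T t p M) has_derivative D) (at (t, p, M) within {0<..} \<times> UNIV \<times> sym_mats)"
    and t: "t > 0" and M: "M \<in> sym_mats" and H: "H \<in> sym_mats"
  shows "D (0, 0, H) = matrix_deriv (T t p) M \<bullet> H"
proof -
  have "((\<lambda>N. (case (t, N) of (t, p, M) \<Rightarrow> T t p M)) has_derivative (\<lambda>H. D (0, H))) (at (p, M) within UNIV \<times> sym_mats)"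
    by (rule has_derivative_last_component[OF T]) (use t in simp)
  from has_derivative_last_component[OF this UNIV_I]
  have "(T t p has_derivative (\<lambda>H. D (0, 0, H))) (at M within sym_mats)"
    by simp
  from matrix_deriv_inner[OF M H this] show ?thesis .
qed

lemma elliptic_decreasing:
  fixes T :: "real \<Rightarrow> real^'n \<Rightarrow> real^'n^'n \<Rightarrow> real"
  assumes ell: "elliptic T" and t: "t > 0" and M: "M \<in> sym_mats" and H: "H \<in> sym_mats"
    and psd: "\<And>x. 0 \<le> x \<bullet> (H *v x)"
  shows "matrix_deriv (T t p) M \<bullet> H \<le> 0"
proof -
  have A: "pos_def (- matrix_deriv (T t p) M)" using ell t M by (simp add: elliptic_def)
  have "0 \<le> x \<bullet> (- matrix_deriv (T t p) M *v x)" for x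
    using A unfolding pos_def_def by (cases "x = 0") (auto intro: less_imp_le)
  from psd_inner_nonneg[OF this H psd] show ?thesis by simp
qed

lemma elliptic_trace_neg:
  fixes T :: "real \<Rightarrow> real^'n \<Rightarrow> real^'n^'n \<Rightarrow> real"
  assumes ell: "elliptic T" and t: "t > 0" and M: "M \<in> sym_mats"
  shows "matrix_deriv (T t p) M \<bullet> mat 1 < 0"
proof -
  let ?A = "- matrix_deriv (T t p) M"
  have A: "pos_def ?A" using ell t M by (simp add: elliptic_def)
  have p: "0 < ?A $ i $ i" for i
  proof -
    have "0 < axis i 1 \<bullet> (?A *v axis i 1)" using A unfolding pos_def_def by (simp add: axis_eq_0_iff)
    then show ?thesis by (simp only: inner_axis_matrix_vector)
  qed
  have "?A \<bullet> mat 1 = (\<Sum>i\<in>UNIV. ?A $ i $ i)"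
    by (simp add: inner_vec_def mat_def if_distrib[of "\<lambda>x. _ * x"] cong: if_cong)
  also have "\<dots> > 0" by (rule sum_pos) (use p in auto)
  finally show ?thesis by simp
qed

lemma elliptic_of_cases:
  fixes S :: "real^'n \<Rightarrow> real^'n^'n \<Rightarrow> real"
    and T :: "real \<Rightarrow> real^'n \<Rightarrow> real^'n^'n \<Rightarrow> real"
  assumes S_C1: "C1_on (\<lambda>(p, M). S p M) (UNIV \<times> sym_mats)"
    and S_ell: "\<And>p M. M \<in> sym_mats \<Longrightarrow> pos_def (- matrix_deriv (S p) M)"
    and T: "(\<forall>t>0. \<forall>p. \<forall>M\<in>sym_mats. T t p M = S p M)
       \<or> elliptic T
       \<or> (\<forall>t>0. \<forall>p. \<forall>M\<in>sym_mats.
              T t p M = S ((1 / (t + 1)) *\<^sub>R p) ((1 / (t + 1)) *\<^sub>R M))"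
  shows "elliptic T"
  using T
proof (elim disjE)
  assume eq: "\<forall>t>0. \<forall>p. \<forall>M\<in>sym_mats. T t p M = S p M"
  have "matrix_deriv (T t p) = matrix_deriv (S p)" if "t > 0" for t p
    by (rule matrix_deriv_cong) (use eq that in auto)
  then show ?thesis using S_ell by (simp add: elliptic_def)
next
  assume eq: "\<forall>t>0. \<forall>p. \<forall>M\<in>sym_mats. T t p M = S ((1 / (t + 1)) *\<^sub>R p) ((1 / (t + 1)) *\<^sub>R M)"
  show ?thesis unfolding elliptic_def
  proof (intro allI impI ballI)
    fix t :: real and p :: "real^'n" and M :: "real^'n^'n"
    assume t: "t > 0" and M: "M \<in> sym_mats"
    define c where "c = 1 / (t + 1)"
    have c: "c > 0" using t by (simp add: c_def)
    have cM: "c *\<^sub>R M \<in> sym_mats" using M by (rule sym_mats_scaleR)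
    have "\<exists>D. ((\<lambda>(p, M). S p M) has_derivative D) (at (c *\<^sub>R p, c *\<^sub>R M) within UNIV \<times> sym_mats)"
      using S_C1 cM unfolding C1_on_def by blast
    then obtain D where "((\<lambda>(p, M). S p M) has_derivative D) (at (c *\<^sub>R p, c *\<^sub>R M) within UNIV \<times> sym_mats)"
      by blast
    from has_derivative_last_component[OF this UNIV_I]
    have S': "(S (c *\<^sub>R p) has_derivative (\<lambda>H. D (0, H))) (at (c *\<^sub>R M) within sym_mats)" by simp
    have "matrix_deriv (T t p) = matrix_deriv (\<lambda>N. S (c *\<^sub>R p) (c *\<^sub>R N))"
      by (rule matrix_deriv_cong) (use eq t in \<open>auto simp: c_def\<close>)
    then have e: "- matrix_deriv (T t p) M = c *\<^sub>R (- matrix_deriv (S (c *\<^sub>R p)) (c *\<^sub>R M))"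
      using matrix_deriv_rescale[OF M S'] by simp
    have "pos_def (c *\<^sub>R A)" if "pos_def A" for A :: "real^'n^'n"
      using that c sym_mats_scaleR[of A c]
      by (simp add: pos_def_def sym_mats_def scaleR_matrix_vector_assoc[symmetric])
    then show "pos_def (- matrix_deriv (T t p) M)"
      unfolding e using S_ell[OF cM] by blast
  qed
qed


section \<open>Superharmonic functions near an isolated singularity\<close>

text \<open>Minimizing sequences can escape neither into the puncture nor to the sphere, because the
  values there are no smaller than the negative value at \<open>z\<close>. This is how every contact
  point is placed away from the singularity.\<close>

lemma punctured_ball_min:
  fixes F :: "'a::euclidean_space \<Rightarrow> real"
  assumes cont: "continuous_on (cball 0 r - {0}) F"
    and z: "z \<in> cball 0 r - {0}" "F z < 0"
    and bd: "\<And>x. norm x = r \<Longrightarrow> 0 \<le> F x"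
    and near: "eventually (\<lambda>x. F z \<le> F x) (at 0)"
  shows "\<exists>x\<in>ball 0 r - {0}. F x < 0 \<and> (\<forall>y\<in>ball 0 r - {0}. F x \<le> F y)"
proof -
  obtain d where d: "d > 0" "\<And>x. x \<noteq> 0 \<Longrightarrow> norm x < d \<Longrightarrow> F z \<le> F x"
    using near by (auto simp: eventually_at)
  define K where "K = cball 0 r - ball (0::'a) (min d (norm z))"
  have K: "compact K" by (auto simp: K_def intro: compact_diff)
  have zK: "z \<in> K" using z by (simp add: K_def)
  have "K \<subseteq> cball 0 r - {0}" using d(1) z by (auto simp: K_def)
  then have "continuous_on K F" using cont continuous_on_subset by blast
  then obtain x where x: "x \<in> K" "\<And>y. y \<in> K \<Longrightarrow> F x \<le> F y"
    using continuous_attains_inf[OF K] zK by blast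
  have xz: "F x \<le> F z" using x(2)[OF zK] .
  show ?thesis
  proof (intro bexI[of _ x] conjI ballI)
    have "x \<noteq> 0" "norm x \<le> r" using x(1) z(1) d(1) by (auto simp: K_def)
    moreover have "norm x \<noteq> r" using bd[of x] xz z(2) by auto
    ultimately show "x \<in> ball 0 r - {0}" by auto
    show "F x < 0" using xz z(2) by simp
    show "F x \<le> F y" if y: "y \<in> ball 0 r - {0}" for y
    proof (cases "norm y < d")
      case True
      then show ?thesis using d(2)[of y] y xz by auto
    next
      case False
      then show ?thesis using y by (intro x(2)) (auto simp: K_def)
    qed
  qed
qed

lemma laplacian_eq_sum: "laplacian f x = (\<Sum>i\<in>UNIV. axis i 1 \<bullet> (hessian f x *v axis i 1))"
  by (simp add: inner_axis_matrix_vector laplacian_def hessian_def)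

text \<open>The affine function is lowered by \<open>e (ln (r / |x|) + r\<^sup>2 - |x|\<^sup>2)\<close>. This vanishes on
  the sphere, tends to infinity at the puncture, and the Laplacian of the lowered function
  is \<open>e ((n - 2) / |x|\<^sup>2 + 2 n) > 0\<close>, where the logarithm contributes a nonnegative
  term because \<open>n \<ge> 2\<close>. Therefore \<open>u\<close> cannot touch it from above at an interior
  point. Finally \<open>e\<close> tends to zero.\<close>

lemma superharmonic_ge_affine:
  fixes u :: "real^'n \<Rightarrow> real"
  assumes n: "CARD('n) \<ge> 2"
    and u: "C2_on u (ball 0 R - {0})"
    and sh: "\<And>x. x \<in> ball 0 R - {0} \<Longrightarrow> laplacian u x \<le> 0"
    and bdd: "\<And>x. x \<in> ball 0 R - {0} \<Longrightarrow> B \<le> u x"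
    and r: "0 < r" "r < R"
    and bd: "\<And>x. norm x = r \<Longrightarrow> A + q \<bullet> x \<le> u x"
    and x0: "x0 \<in> ball 0 r - {0}"
  shows "A + q \<bullet> x0 \<le> u x0"
proof -
  let ?h = "\<lambda>x. ln (x \<bullet> x) / 2 - ln r + (x \<bullet> x - r\<^sup>2)"
  have main: "A + q \<bullet> x0 + e * ?h x0 \<le> u x0" if e: "e > 0" for e
  proof (rule ccontr)
    let ?g = "\<lambda>x. A + q \<bullet> x + e * ?h x"
    let ?F = "\<lambda>x. u x - ?g x"
    assume neg: "\<not> ?thesis"
    have uc: "continuous_on (cball 0 r - {0}) u"
      by (rule continuous_on_subset[OF C2_on_imp_continuous_on[OF u]]) (use r in \<open>auto simp: open_Diff\<close>)
    have cont: "continuous_on (cball 0 r - {0}) ?F"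
      by (intro continuous_intros uc) auto
    have near: "eventually (\<lambda>x. ?F x0 \<le> ?F x) (at 0)"
    proof -
      \<comment> \<open>when \<open>ln (x \<bullet> x)\<close> is below \<open>2 (K + ln r)\<close>, the lower bounds for \<open>u\<close> and for the affine part force \<open>?F x \<ge> ?F x0\<close>\<close>
      define K where "K = (B - \<bar>A\<bar> - norm q * r - ?F x0) / e"
      have "filterlim (\<lambda>x::real^'n. x \<bullet> x) (at_right 0) (at 0)"
        unfolding filterlim_at
        by (auto simp: eventually_at_filter intro!: tendsto_eq_intros)
      then have "filterlim (\<lambda>x::real^'n. ln (x \<bullet> x)) at_bot (at 0)"
        by (rule filterlim_compose[OF ln_at_0])
      then have 1: "eventually (\<lambda>x::real^'n. ln (x \<bullet> x) \<le> 2 * (K + ln r)) (at 0)"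
        by (simp add: filterlim_at_bot)
      have 2: "eventually (\<lambda>x::real^'n. x \<in> ball 0 r - {0}) (at 0)"
        using r(1) by (auto simp: eventually_at)
      from 1 2 show ?thesis
      proof eventually_elim
        fix x :: "real^'n"
        assume l: "ln (x \<bullet> x) \<le> 2 * (K + ln r)"
          and x: "x \<in> ball 0 r - {0}"
        have "norm x \<le> r" using x by simp
        have "q \<bullet> x \<le> norm q * norm x" by (rule norm_cauchy_schwarz)
        also have "\<dots> \<le> norm q * r" using \<open>norm x \<le> r\<close> by (intro mult_left_mono) auto
        finally have a: "q \<bullet> x \<le> norm q * r" .
        have "x \<bullet> x \<le> r\<^sup>2"
          unfolding power2_norm_eq_inner[symmetric] using \<open>norm x \<le> r\<close> by (intro power_mono) auto
        with l have "?h x \<le> K" by argo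
        then have "e * ?h x \<le> B - \<bar>A\<bar> - norm q * r - ?F x0"
          using e by (simp add: K_def pos_le_divide_eq mult.commute)
        moreover have "B \<le> u x" using x r by (intro bdd) auto
        ultimately show "?F x0 \<le> ?F x" using a by linarith
      qed
    qed
    have bdF: "0 \<le> ?F x" if "norm x = r" for x
    proof -
      have "x \<bullet> x = r\<^sup>2" using that by (simp add: power2_norm_eq_inner[symmetric])
      then have "?h x = 0" using r(1) by (simp add: ln_realpow)
      then show ?thesis using bd[OF that] by simp
    qed
    have x0': "x0 \<in> cball 0 r - {0}" "?F x0 < 0" using x0 neg by auto
    obtain x where x: "x \<in> ball 0 r - {0}" and "?F x < 0" and min: "\<And>y. y \<in> ball 0 r - {0} \<Longrightarrow> ?F x \<le> ?F y"
      using punctured_ball_min[OF cont x0' bdF near] by blast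
    let ?U = "ball (0::real^'n) r - {0}"
    have U: "open ?U" by (simp add: open_Diff)
    have uU: "C2_on u ?U" 
      by (rule C2_on_subset[OF u]) (use r in auto)
    define a where "a = x \<bullet> x"
    have a: "a > 0" using x by (simp add: a_def)
    have H: "e * ((y \<bullet> y) / a - 2 * (x \<bullet> y)\<^sup>2 / a\<^sup>2) + 2 * e * (y \<bullet> y) \<le> y \<bullet> (hessian u x *v y)" for y
    proof -
      obtain d where d: "d > 0" "\<And>s. \<bar>s\<bar> < d \<Longrightarrow> x + s *\<^sub>R y \<in> ?U"
        using line_in_open[OF U x] by blast
      have e1: "(x + s *\<^sub>R y) \<bullet> (x + s *\<^sub>R y) = x \<bullet> x + 2 * s * (x \<bullet> y) + s\<^sup>2 * (y \<bullet> y)" for s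
        by (simp add: inner_add_left inner_add_right inner_commute[of y x] power2_eq_square algebra_simps)
      have e2: "q \<bullet> (x + s *\<^sub>R y) = q \<bullet> x + s * (q \<bullet> y)" "(x + s *\<^sub>R y) \<bullet> y = x \<bullet> y + s * (y \<bullet> y)" for s
        by (simp_all add: inner_add_left inner_add_right)
      show ?thesis
      proof (rule touching_from_below(2)[OF uU U x, where g = ?g and d = d and
            g' = "\<lambda>s. q \<bullet> y + e * (((x + s *\<^sub>R y) \<bullet> y) / ((x + s *\<^sub>R y) \<bullet> (x + s *\<^sub>R y)) + 2 * ((x + s *\<^sub>R y) \<bullet> y))"])
        show "d > 0" by fact
        show "?F x \<le> ?F z" if "z \<in> ?U" for z using min[OF that] .
        show "((\<lambda>s. ?g (x + s *\<^sub>R y)) has_field_derivative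
            q \<bullet> y + e * (((x + s *\<^sub>R y) \<bullet> y) / ((x + s *\<^sub>R y) \<bullet> (x + s *\<^sub>R y)) + 2 * ((x + s *\<^sub>R y) \<bullet> y))) (at s)"
          if s: "\<bar>s\<bar> < d" for s
        proof -
          have "(x + s *\<^sub>R y) \<bullet> (x + s *\<^sub>R y) > 0" using d(2)[OF s] by auto
          then have p: "x \<bullet> x + 2 * s * (x \<bullet> y) + s\<^sup>2 * (y \<bullet> y) > 0"
            unfolding e1 .
          show ?thesis
            unfolding e1 e2 using p
            by (auto intro!: derivative_eq_intros simp: field_simps)
        qed
        show "((\<lambda>s. q \<bullet> y + e * (((x + s *\<^sub>R y) \<bullet> y) / ((x + s *\<^sub>R y) \<bullet> (x + s *\<^sub>R y)) + 2 * ((x + s *\<^sub>R y) \<bullet> y)))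
          has_field_derivative e * ((y \<bullet> y) / a - 2 * (x \<bullet> y)\<^sup>2 / a\<^sup>2) + 2 * e * (y \<bullet> y)) (at 0)"
          unfolding e1 e2 using a
          by (auto intro!: derivative_eq_intros simp: a_def[symmetric] power2_eq_square field_simps)
      qed
    qed
    have "(\<Sum>i\<in>UNIV. e * (1 / a - 2 * (x $ i)\<^sup>2 / a\<^sup>2) + 2 * e) \<le> laplacian u x"
      unfolding laplacian_eq_sum
    proof (rule sum_mono)
      fix i
      show "e * (1 / a - 2 * (x $ i)\<^sup>2 / a\<^sup>2) + 2 * e \<le> axis i 1 \<bullet> (hessian u x *v axis i 1)"
        using H[of "axis i 1"] by (simp add: inner_axis inner_axis_axis)
    qed
    also have "\<dots> \<le> 0" using x r by (intro sh) auto
    also have "(\<Sum>i\<in>UNIV. e * (1 / a - 2 * (x $ i)\<^sup>2 / a\<^sup>2) + 2 * e)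
        = e * (CARD('n) / a - 2 / a\<^sup>2 * (\<Sum>i\<in>UNIV. (x $ i)\<^sup>2)) + 2 * e * CARD('n)"
      by (simp add: sum.distrib sum_subtractf sum_distrib_left sum_distrib_right sum_divide_distrib algebra_simps)
    also have "(\<Sum>i\<in>UNIV. (x $ i)\<^sup>2) = a"
      by (simp add: a_def inner_vec_def power2_eq_square)
    also have "e * (CARD('n) / a - 2 / a\<^sup>2 * a) + 2 * e * CARD('n) = e * ((real CARD('n) - 2) / a) + 2 * e * CARD('n)"
      using a by (simp add: power2_eq_square field_simps)
    finally have "e * ((real CARD('n) - 2) / a) + 2 * e * CARD('n) \<le> 0" .
    moreover have "e * ((real CARD('n) - 2) / a) \<ge> 0" using n e a by simp
    moreover have "2 * e * real CARD('n) > 0" using n e by simp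
    ultimately show False by linarith
  qed
  have "((\<lambda>e. A + q \<bullet> x0 + e * ?h x0) \<longlongrightarrow> A + q \<bullet> x0 + 0 * ?h x0) (at_right 0)"
    by (intro tendsto_intros)
  then show ?thesis
    using main by (intro tendsto_upperbound[where F = "at_right (0::real)"])
      (auto simp: eventually_at_right_less intro: eventually_mono[OF eventually_at_right_less])
qed

text \<open>On the sphere of radius \<open>s\<close> the term \<open>e |x|\<close> contributes \<open>e s\<close>, and replacing \<open>v\<close> by its tangent plane,
  by differentiability, costs at most a quarter of this on the sphere
  and another quarter inside it.\<close>

lemma superharmonic_above_cone:
  fixes u v :: "real^'n \<Rightarrow> real"
  assumes n: "CARD('n) \<ge> 2"
    and u: "C2_on u (ball 0 R - {0})"
    and sh: "\<And>x. x \<in> ball 0 R - {0} \<Longrightarrow> laplacian u x \<le> 0"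
    and bdd: "\<And>x. x \<in> ball 0 R - {0} \<Longrightarrow> B \<le> u x"
    and v: "(v has_derivative (\<lambda>h. q \<bullet> h)) (at 0)"
    and R: "0 < R" and e: "0 < e" and r: "0 < r"
    and cone: "\<And>x. x \<in> ball 0 r - {0} \<Longrightarrow> v x + e * norm x \<le> u x"
  shows "\<exists>c>0. eventually (\<lambda>x. c \<le> u x - v x) (at 0)"
proof -
  obtain d where d: "d > 0" "\<And>x. norm x < d \<Longrightarrow> \<bar>v x - v 0 - q \<bullet> x\<bar> \<le> e / 4 * norm x"
    using v e unfolding has_derivative_at_alt by (auto dest: spec[of _ "e / 4"])
  define s where "s = min d (min r R) / 2"
  have s: "0 < s" "s < d" "s < r" "s < R" using d R r by (auto simp: s_def)
  have bd: "(v 0 + 3 / 4 * e * s) + q \<bullet> x \<le> u x" if "norm x = s" for x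
  proof -
    have "x \<noteq> 0" using that s(1) by auto
    then have "v x + e * s \<le> u x" using cone[of x] that s by auto
    moreover have "\<bar>v x - v 0 - q \<bullet> x\<bar> \<le> e / 4 * s" using d(2)[of x] that s by simp
    ultimately show ?thesis by argo
  qed
  have "e * s / 2 \<le> u x - v x" if x: "x \<in> ball 0 s - {0}" for x
  proof -
    have "(v 0 + 3 / 4 * e * s) + q \<bullet> x \<le> u x"
      by (rule superharmonic_ge_affine[OF n u sh bdd s(1,4) bd x])
    moreover have "\<bar>v x - v 0 - q \<bullet> x\<bar> \<le> e / 4 * norm x" using d(2)[of x] x s by simp
    moreover have "e / 4 * norm x \<le> e / 4 * s" using x e by (intro mult_left_mono) auto
    ultimately show ?thesis by argo
  qed
  then have "eventually (\<lambda>x. e * s / 2 \<le> u x - v x) (at 0)"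
    using s(1) unfolding eventually_at by (auto intro!: exI[of _ s])
  then show ?thesis using e s(1) by (intro exI[of _ "e * s / 2"]) auto
qed

section \<open>Comparison at the singular point\<close>

text \<open>The path from the jet \<open>(t, p, M)\<close> to \<open>(t', p', M')\<close> is split at
  \<open>(t', p', M + 2\<delta> I)\<close>. The first half stays near \<open>Qc\<close>, where the derivative of \<open>T\<close>
  is controlled: the gain \<open>2\<delta> l\<close> along the identity beats the change
  \<open>\<Lambda> (|t' - t| + |p' - p|)\<close>. On the second half only the matrix increases, so monotonicity
  suffices and \<open>M'\<close> may be far away; no bound on the Hessian of \<open>u\<close> is
  available near its singularity.\<close>

lemma elliptic_strict_contact:
  fixes T :: "real \<Rightarrow> real^'n \<Rightarrow> real^'n^'n \<Rightarrow> real"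
    and T' :: "real \<times> (real^'n) \<times> (real^'n^'n) \<Rightarrow> (real \<times> (real^'n) \<times> (real^'n^'n)) \<Rightarrow>\<^sub>L real"
  defines "X \<equiv> {0<..} \<times> UNIV \<times> sym_mats"
  assumes T': "\<And>Q. Q \<in> X \<Longrightarrow> ((\<lambda>(t, p, M). T t p M) has_derivative T' Q) (at Q within X)"
    and ell: "elliptic T"
    and near: "\<And>Q. Q \<in> X \<Longrightarrow> dist Q Qc < \<eta> \<Longrightarrow> norm (T' Q) \<le> \<Lambda> \<and> T' Q (0, 0, mat 1) \<le> - l"
    and P0: "(t, p, M) \<in> X" and P0_near: "dist (t, p, M) Qc < \<eta> / 2"
    and P2: "t' > 0" "M' \<in> sym_mats"
    and hess: "\<And>y. y \<bullet> (M *v y) + 2 * \<delta> * (y \<bullet> y) \<le> y \<bullet> (M' *v y)"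
    and small: "\<bar>t' - t\<bar> + norm (p' - p) + 2 * \<delta> * norm (mat 1 :: real^'n^'n) < \<eta> / 2"
    and strict: "\<Lambda> * (\<bar>t' - t\<bar> + norm (p' - p)) < 2 * \<delta> * l"
    and \<delta>: "\<delta> > 0"
  shows "T t' p' M' < T t p M"
proof -
  let ?G = "\<lambda>(t, p, M). T t p M"
  let ?M1 = "M + (2 * \<delta>) *\<^sub>R mat 1"
  let ?P0 = "(t, p, M)" and ?P1 = "(t', p', ?M1)" and ?P2 = "(t', p', M')"
  have Msym: "M \<in> sym_mats" using P0 by (simp add: X_def)
  have M1: "?M1 \<in> sym_mats" by (intro sym_mats_add sym_mats_scaleR Msym mat_1_sym)
  have X: "convex X" unfolding X_def by (intro convex_Times convex_sym_mats) auto
  have P1X: "?P1 \<in> X" "?P2 \<in> X" using P2 M1 by (auto simp: X_def)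
  have inX: "z \<in> X" if "z \<in> closed_segment P Q" "P \<in> X" "Q \<in> X" for z P Q
    using closed_segment_subset[OF that(2,3) X] that(1) by blast
  have "?G ?P2 \<le> ?G ?P1"
  proof -
    obtain z where z: "z \<in> closed_segment ?P1 ?P2" "?G ?P2 - ?G ?P1 = T' z (?P2 - ?P1)"
      using mean_value_within_convex[OF X P1X T'] by blast
    have zX: "z \<in> X" using inX[OF z(1) P1X] .
    obtain s w N where zz: "z = (s, w, N)" by (metis surj_pair)
    have "T' z (0, 0, M' - ?M1) = matrix_deriv (T s w) N \<bullet> (M' - ?M1)"
      using T'[OF zX] zX P2 M1 unfolding zz X_def by (intro matrix_deriv_pair) (auto intro: sym_mats_diff)
    also have "\<dots> \<le> 0"
    proof (rule elliptic_decreasing[OF ell])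
      show "s > 0" "N \<in> sym_mats" using zX by (auto simp: zz X_def)
      show "M' - ?M1 \<in> sym_mats" using P2 M1 by (intro sym_mats_diff)
      show "0 \<le> y \<bullet> ((M' - ?M1) *v y)" for y
        using hess[of y] by (simp add: matrix_vector_mult_diff_rdistrib matrix_vector_mult_add_rdistrib
            scaleR_matrix_vector_assoc[symmetric] inner_diff_right inner_add_right)
    qed
    finally show ?thesis using z(2) by simp
  qed
  also have "?G ?P1 < ?G ?P0"
  proof -
    obtain z where z: "z \<in> closed_segment ?P0 ?P1" "?G ?P1 - ?G ?P0 = T' z (?P1 - ?P0)"
      using mean_value_within_convex[OF X P0 P1X(1) T'] by blast
    have zX: "z \<in> X" using inX[OF z(1) P0 P1X(1)] .
    have ab: "norm (t' - t, p' - p, 0 :: real^'n^'n) \<le> \<bar>t' - t\<bar> + norm (p' - p)"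
      using norm_Pair_le[of "t' - t" "(p' - p, 0 :: real^'n^'n)"] norm_Pair_le[of "p' - p" "0 :: real^'n^'n"]
      by simp
    have e: "?P1 - ?P0 = (t' - t, p' - p, 0) + (2 * \<delta>) *\<^sub>R (0, 0, mat 1)" by simp
    have "dist ?P1 ?P0 \<le> norm (t' - t, p' - p, 0 :: real^'n^'n) + norm ((2 * \<delta>) *\<^sub>R (0 :: real, 0 :: real^'n, mat 1 :: real^'n^'n))"
      unfolding dist_norm e by (rule norm_triangle_ineq)
    also have "\<dots> \<le> \<bar>t' - t\<bar> + norm (p' - p) + 2 * \<delta> * norm (mat 1 :: real^'n^'n)"
      using ab \<delta> by (simp add: norm_Pair)
    finally have d: "dist ?P1 ?P0 < \<eta> / 2" using small by simp
    have "dist z ?P0 \<le> dist ?P1 ?P0"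
      using z(1) segment_bound(1)[of z ?P0 ?P1] by (simp add: dist_norm norm_minus_commute)
    then have "dist z Qc < \<eta>" using d P0_near dist_triangle[of z Qc ?P0] by linarith
    from near[OF zX this] have b: "norm (T' z) \<le> \<Lambda>" "T' z (0, 0, mat 1) \<le> - l" by auto
    have "T' z (?P1 - ?P0) = T' z (t' - t, p' - p, 0) + 2 * \<delta> * T' z (0, 0, mat 1)"
      unfolding e blinfun.add_right blinfun.scaleR_right by simp
    moreover have "T' z (t' - t, p' - p, 0) \<le> \<Lambda> * (\<bar>t' - t\<bar> + norm (p' - p))"
    proof -
      have "T' z (t' - t, p' - p, 0) \<le> norm (T' z (t' - t, p' - p, 0))" by simp
      also have "\<dots> \<le> norm (T' z) * norm (t' - t, p' - p, 0 :: real^'n^'n)" by (rule norm_blinfun)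
      also have "\<dots> \<le> \<Lambda> * (\<bar>t' - t\<bar> + norm (p' - p))"
        by (rule mult_mono[OF b(1) ab]) (use b(1) norm_ge_zero[of "T' z"] in linarith, simp)
      finally show ?thesis .
    qed
    moreover have "2 * \<delta> * T' z (0, 0, mat 1) \<le> 2 * \<delta> * (- l)"
      using b(2) \<delta> by (intro mult_left_mono) auto
    ultimately show ?thesis using z(2) strict by linarith
  qed
  finally show ?thesis by simp
qed

text \<open>If the cone with slope \<open>\<delta> r\<close> is crossed at \<open>x0\<close>, the linear function
  \<open>\<xi> \<bullet> x\<close> that agrees with \<open>\<delta> r |x|\<close> at \<open>x0\<close> tilts the perturbed
  \<open>v\<close> so that contact with \<open>u\<close> occurs away from the puncture. The constants are
  chosen in order: \<open>\<eta>, l, L\<close> control the derivative of \<open>T\<close> near the jet of \<open>v\<close> at \<open>0\<close>;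
  \<open>r\<close> depends on these, so that \<open>2\<delta> I\<close> dominates; \<open>\<delta>\<close> comes last, small
  with respect to \<open>\<eta>\<close> and to the gap \<open>c\<close> between \<open>u\<close> and \<open>v\<close> on the sphere of radius \<open>r\<close>.\<close>

lemma cone_below_solution:
  fixes T :: "real \<Rightarrow> real^'n \<Rightarrow> real^'n^'n \<Rightarrow> real"
    and u v :: "real^'n \<Rightarrow> real"
  assumes T_C1: "C1_on (\<lambda>(t, p, M). T t p M) ({0<..} \<times> UNIV \<times> sym_mats)"
    and ell: "elliptic T"
    and R: "R > 0"
    and u_C2: "C2_on u (ball 0 R - {0})"
    and v_C2: "C2_on v (ball 0 R)"
    and v_pos: "\<And>x. x \<in> ball 0 R \<Longrightarrow> v x > 0"
    and u_gt_v: "\<And>x. x \<in> ball 0 R - {0} \<Longrightarrow> u x > v x"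
    and T_u: "\<And>x. x \<in> ball 0 R - {0} \<Longrightarrow> T (u x) (gradient u x) (hessian u x) \<ge> 0"
    and T_v: "\<And>x. x \<in> ball 0 R - {0} \<Longrightarrow> 0 \<ge> T (v x) (gradient v x) (hessian v x)"
  shows "\<exists>e>0. \<exists>r>0. \<forall>x\<in>ball 0 r - {0}. v x + e * norm x \<le> u x"
proof -
  let ?B = "ball (0::real^'n) R"
  define X where "X = ({0<..} :: real set) \<times> (UNIV :: (real^'n) set) \<times> (sym_mats :: (real^'n^'n) set)"
  obtain T' :: "real \<times> (real^'n) \<times> (real^'n^'n) \<Rightarrow> (real \<times> (real^'n) \<times> (real^'n^'n)) \<Rightarrow>\<^sub>L real"
    where T': "\<And>Q. Q \<in> X \<Longrightarrow> ((\<lambda>(t, p, M). T t p M) has_derivative T' Q) (at Q within X)"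
      and T'c: "continuous_on X T'"
    using T_C1 unfolding C1_on_def X_def by blast
  define J where "J x = (v x, gradient v x, hessian v x)" for x
  have JX: "J x \<in> X" if "x \<in> ?B" for x
    using v_pos[OF that] hessian_symmetric[OF v_C2 open_ball that] by (simp add: J_def X_def)
  have Jc: "continuous_on ?B J"
    unfolding J_def using v_C2
    by (intro continuous_on_Pair C2_on_imp_continuous_on C2_on_continuous_hessian C1_on_continuous_gradient)
       (auto simp: C2_on_def)
  define Q0 where "Q0 = J 0"
  have Q0: "Q0 \<in> X" using JX[of 0] R by (simp add: Q0_def)
  define l where "l = - T' Q0 (0, 0, mat 1) / 2"
  define L where "L = norm (T' Q0) + 1"
  have l: "l > 0"
  proof -
    have "T' Q0 (0, 0, mat 1) = matrix_deriv (T (v 0) (gradient v 0)) (hessian v 0) \<bullet> mat 1"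
      using T'[OF Q0] Q0 unfolding Q0_def J_def X_def
      by (intro matrix_deriv_pair) (auto intro: mat_1_sym)
    also have "\<dots> < 0"
      using Q0 unfolding Q0_def J_def X_def by (intro elliptic_trace_neg ell) auto
    finally show ?thesis by (simp add: l_def)
  qed
  have L: "L > 0" using norm_ge_zero[of "T' Q0"] by (simp add: L_def add_nonneg_pos)
  have LT: "norm (T' Q0) < L" unfolding L_def by (rule less_add_one)
  obtain \<eta> where \<eta>: "\<eta> > 0"
    "\<And>Q. Q \<in> X \<Longrightarrow> dist Q Q0 < \<eta> \<Longrightarrow> norm (T' Q) \<le> L \<and> T' Q (0, 0, mat 1) \<le> - l"
  proof -
    have lim: "(T' \<longlongrightarrow> T' Q0) (at Q0 within X)"
      using T'c Q0 by (simp add: continuous_on_def)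
    then have "eventually (\<lambda>Q. norm (T' Q) < L) (at Q0 within X)"
      by (rule order_tendstoD(2)[OF tendsto_norm _]) (rule LT)
    moreover have "((\<lambda>Q. T' Q (0, 0, mat 1)) \<longlongrightarrow> T' Q0 (0, 0, mat 1)) (at Q0 within X)"
      by (intro tendsto_intros lim)
    then have "eventually (\<lambda>Q. T' Q (0, 0, mat 1) < - l) (at Q0 within X)"
      by (rule order_tendstoD(2)) (use l in \<open>simp add: l_def\<close>)
    ultimately have "eventually (\<lambda>Q. norm (T' Q) \<le> L \<and> T' Q (0, 0, mat 1) \<le> - l) (at Q0 within X)"
      by eventually_elim auto
    then obtain d where d: "d > 0"
      "\<And>Q. Q \<in> X \<Longrightarrow> Q \<noteq> Q0 \<Longrightarrow> dist Q Q0 < d \<Longrightarrow> norm (T' Q) \<le> L \<and> T' Q (0, 0, mat 1) \<le> - l"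
      unfolding eventually_at by blast
    have at0: "norm (T' Q0) \<le> L \<and> T' Q0 (0, 0, mat 1) \<le> - l"
      using l by (simp add: L_def l_def)
    show ?thesis
    proof (rule that[OF d(1)])
      show "norm (T' Q) \<le> L \<and> T' Q (0, 0, mat 1) \<le> - l" if "Q \<in> X" "dist Q Q0 < d" for Q
        using d(2)[OF that(1) _ that(2)] at0 by (cases "Q = Q0") blast+
    qed
  qed
  obtain d1 where d1: "d1 > 0" "\<And>x. norm x < d1 \<Longrightarrow> dist (J x) Q0 < \<eta> / 2"
  proof -
    have "isCont J 0" using Jc R by (simp add: continuous_on_eq_continuous_at)
    then show ?thesis using \<eta>(1) that unfolding continuous_at_eps_delta Q0_def
      by (metis dist_0_norm dist_commute half_gt_zero)
  qed
  define r where "r = min (min 1 (R / 2)) (min (d1 / 2) (l / (5 * L)))"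
  have r: "0 < r" "r \<le> 1" "r < R" "r < d1" using R d1(1) l L by (auto simp: r_def)
  have rL: "5 * L * r \<le> l"
  proof -
    have "r \<le> l / (5 * L)" by (simp add: r_def)
    then show ?thesis using L by (simp add: field_simps)
  qed
  have uc: "continuous_on (cball 0 r - {0}) u"
    by (rule continuous_on_subset[OF C2_on_imp_continuous_on[OF u_C2]]) (use r in \<open>auto simp: open_Diff\<close>)
  have vc: "continuous_on (cball 0 r - {0}) v"
    by (rule continuous_on_subset[OF C2_on_imp_continuous_on[OF v_C2]]) (use r in auto)
  obtain c where c: "c > 0" "\<And>x. norm x = r \<Longrightarrow> c \<le> u x - v x"
  proof -
    have "continuous_on (sphere 0 r) (\<lambda>x. u x - v x)"
      by (rule continuous_on_subset[OF continuous_on_diff[OF uc vc]]) (use r in auto)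
    moreover have "sphere (0::real^'n) r \<noteq> {}" using r(1) by simp
    ultimately obtain y where y: "y \<in> sphere 0 r" "\<And>x. x \<in> sphere 0 r \<Longrightarrow> u y - v y \<le> u x - v x"
      using continuous_attains_inf[of "sphere (0::real^'n) r" "\<lambda>x. u x - v x"] by auto
    show ?thesis
      by (rule that[of "u y - v y"]) (use y u_gt_v[of y] r in auto)
  qed
  define m where "m = norm (mat 1 :: real^'n^'n)"
  have m: "m \<ge> 0" by (simp add: m_def)
  define \<delta> where "\<delta> = min (c / (2 * r\<^sup>2)) (\<eta> / (4 * (5 * r + 2 * m)))"
  have \<delta>: "\<delta> > 0" using c(1) r(1) \<eta>(1) m by (simp add: \<delta>_def add_pos_nonneg)
  have \<delta>c: "2 * \<delta> * r\<^sup>2 \<le> c"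
  proof -
    have "\<delta> \<le> c / (2 * r\<^sup>2)" by (simp add: \<delta>_def)
    then show ?thesis using r(1) by (simp add: field_simps)
  qed
  have \<delta>\<eta>: "5 * \<delta> * r + 2 * \<delta> * m < \<eta> / 2"
  proof -
    have "\<delta> \<le> \<eta> / (4 * (5 * r + 2 * m))" by (simp add: \<delta>_def)
    moreover have "5 * r + 2 * m > 0" using r(1) m by simp
    ultimately have "\<delta> * (4 * (5 * r + 2 * m)) \<le> \<eta>" by (simp add: pos_le_divide_eq)
    then have "4 * (5 * \<delta> * r + 2 * \<delta> * m) \<le> \<eta>" by (simp add: algebra_simps)
    then show ?thesis using \<eta>(1) by argo
  qed
  have "v x0 + (\<delta> * r) * norm x0 \<le> u x0" if x0: "x0 \<in> ball 0 r - {0}" for x0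
  proof (rule ccontr)
    assume neg: "\<not> ?thesis"
    define \<xi> where "\<xi> = (\<delta> * r / norm x0) *\<^sub>R x0"
    have n\<xi>: "norm \<xi> = \<delta> * r" using x0 \<delta> r(1) by (simp add: \<xi>_def)
    have \<xi>x0: "\<xi> \<bullet> x0 = \<delta> * r * norm x0"
      using x0 by (simp add: \<xi>_def power2_norm_eq_inner[symmetric] power2_eq_square)
    let ?h = "\<lambda>x. \<delta> * (x \<bullet> x) + \<xi> \<bullet> x"
    let ?F = "\<lambda>x. u x - (v x + ?h x)"
    have h: "?h x \<le> 2 * \<delta> * r\<^sup>2" if "norm x \<le> r" for x
    proof -
      have "x \<bullet> x \<le> r\<^sup>2"
        unfolding power2_norm_eq_inner[symmetric] using that by (intro power_mono) auto
      then have "\<delta> * (x \<bullet> x) \<le> \<delta> * r\<^sup>2" using \<delta> by (intro mult_left_mono) auto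
      moreover have "\<xi> \<bullet> x \<le> \<delta> * r * r"
      proof -
        have "\<xi> \<bullet> x \<le> norm \<xi> * norm x" by (rule norm_cauchy_schwarz)
        also have "\<dots> \<le> \<delta> * r * r" unfolding n\<xi> using that \<delta> r(1) by (intro mult_left_mono) auto
        finally show ?thesis .
      qed
      ultimately show ?thesis by (simp add: power2_eq_square)
    qed
    have cont: "continuous_on (cball 0 r - {0}) ?F"
      by (intro continuous_intros uc vc)
    have "0 \<le> \<delta> * (x0 \<bullet> x0)" using \<delta> by simp
    then have z: "x0 \<in> cball 0 r - {0}" "?F x0 < 0" using x0 neg \<xi>x0 by auto
    have bd: "0 \<le> ?F x" if "norm x = r" for x
      using c(2)[OF that] h[of x] \<delta>c that by linarith
    have near: "eventually (\<lambda>x. ?F x0 \<le> ?F x) (at 0)"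
    proof -
      have "(?h \<longlongrightarrow> ?h 0) (at 0)" by (intro tendsto_intros)
      then have "eventually (\<lambda>x. ?h x < - ?F x0) (at 0)"
        by (rule order_tendstoD(2)) (use z(2) in simp)
      moreover have "eventually (\<lambda>x. x \<in> ?B - {0}) (at 0)"
        using R by (auto simp: eventually_at)
      ultimately show ?thesis
      proof eventually_elim
        case (elim x)
        then show ?case using u_gt_v[of x] by linarith
      qed
    qed
    obtain x where x: "x \<in> ball 0 r - {0}" and Fx: "?F x < 0"
      and min: "\<And>y. y \<in> ball 0 r - {0} \<Longrightarrow> ?F x \<le> ?F y"
      using punctured_ball_min[OF cont z bd near] by blast
    have xB: "x \<in> ?B - {0}" "x \<in> ?B" "norm x \<le> r" using x r by auto
    let ?U = "ball (0::real^'n) r - {0}"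
    have U: "open ?U" by (simp add: open_Diff)
    have uU: "C2_on u ?U"
      by (rule C2_on_subset[OF u_C2]) (use r in auto)
    have C1v: "C1_on v ?B" using v_C2 by (simp add: C2_on_def)
    have contact: "gradient u x \<bullet> y = gradient v x \<bullet> y + (2 * \<delta> * (x \<bullet> y) + \<xi> \<bullet> y)
        \<and> y \<bullet> (hessian v x *v y) + 2 * \<delta> * (y \<bullet> y) \<le> y \<bullet> (hessian u x *v y)" for y
    proof -
      obtain d where d: "d > 0" "\<And>s. \<bar>s\<bar> < d \<Longrightarrow> x + s *\<^sub>R y \<in> ?B"
        using line_in_open[OF open_ball xB(2)] by blast
      let ?g = "\<lambda>x. v x + ?h x"
      let ?g' = "\<lambda>s. gradient v (x + s *\<^sub>R y) \<bullet> y + (2 * \<delta> * ((x + s *\<^sub>R y) \<bullet> y) + \<xi> \<bullet> y)"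
      let ?k = "y \<bullet> (hessian v x *v y) + 2 * \<delta> * (y \<bullet> y)"
      have hx: "?h (x + s *\<^sub>R y) = \<delta> * (x \<bullet> x + 2 * s * (x \<bullet> y) + s\<^sup>2 * (y \<bullet> y)) + (\<xi> \<bullet> x + s * (\<xi> \<bullet> y))" for s
        by (simp add: inner_add_left inner_add_right inner_commute[of y x] power2_eq_square algebra_simps)
      have hx': "(x + s *\<^sub>R y) \<bullet> y = x \<bullet> y + s * (y \<bullet> y)" for s by (simp add: inner_add_left)
      have g: "((\<lambda>s. ?g (x + s *\<^sub>R y)) has_field_derivative ?g' s) (at s)" if "\<bar>s\<bar> < d" for s
      proof (rule DERIV_add)
        show "((\<lambda>s. v (x + s *\<^sub>R y)) has_field_derivative gradient v (x + s *\<^sub>R y) \<bullet> y) (at s)"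
          by (intro has_field_derivative_line C1_on_has_derivative[OF C1v open_ball d(2)[OF that]])
        show "((\<lambda>s. ?h (x + s *\<^sub>R y)) has_field_derivative 2 * \<delta> * ((x + s *\<^sub>R y) \<bullet> y) + \<xi> \<bullet> y) (at s)"
          unfolding hx hx' by (auto intro!: derivative_eq_intros simp: algebra_simps)
      qed
      have g': "(?g' has_field_derivative ?k) (at 0)"
      proof (rule DERIV_add)
        show "((\<lambda>s. gradient v (x + s *\<^sub>R y) \<bullet> y) has_field_derivative y \<bullet> (hessian v x *v y)) (at 0)"
          by (rule gradient_line_derivative[OF v_C2 open_ball xB(2)])
        show "((\<lambda>s. 2 * \<delta> * ((x + s *\<^sub>R y) \<bullet> y) + \<xi> \<bullet> y) has_field_derivative 2 * \<delta> * (y \<bullet> y)) (at 0)"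
          unfolding hx' by (auto intro!: derivative_eq_intros)
      qed
      show ?thesis
        using touching_from_below[OF uU U x min d(1) g g'] by simp
    qed
    have grad: "gradient u x - gradient v x = (2 * \<delta>) *\<^sub>R x + \<xi>"
    proof -
      have "(gradient u x - gradient v x) \<bullet> y = ((2 * \<delta>) *\<^sub>R x + \<xi>) \<bullet> y" for y
        using contact[of y] by (simp add: inner_diff_left inner_add_left)
      then show ?thesis by (metis vector_eq_rdot)
    qed
    have np: "norm (gradient u x - gradient v x) \<le> 3 * \<delta> * r"
    proof -
      have "norm ((2 * \<delta>) *\<^sub>R x + \<xi>) \<le> 2 * \<delta> * norm x + \<delta> * r"
        using norm_triangle_ineq[of "(2 * \<delta>) *\<^sub>R x" \<xi>] \<delta> by (simp add: n\<xi>)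
      moreover have "2 * \<delta> * norm x \<le> 2 * \<delta> * r" using xB(3) \<delta> by (intro mult_left_mono) auto
      ultimately show ?thesis unfolding grad by linarith
    qed
    \<comment> \<open>the value at the minimum lies between \<open>v x\<close> and the perturbed \<open>v x\<close>, which bounds the difference whatever the depth of the minimum\<close>
    have nt: "\<bar>u x - v x\<bar> \<le> 2 * \<delta> * r"
    proof -
      have "u x - v x \<le> 2 * \<delta> * r\<^sup>2" using Fx h[OF xB(3)] by linarith
      also have "\<dots> \<le> 2 * \<delta> * r" using r \<delta> by (simp add: power2_eq_square mult_left_le_one_le)
      finally show ?thesis using u_gt_v[OF xB(1)] by simp
    qed
    have tot: "\<bar>u x - v x\<bar> + norm (gradient u x - gradient v x) \<le> 5 * \<delta> * r"
      using np nt by linarith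
    have "T (u x) (gradient u x) (hessian u x) < T (v x) (gradient v x) (hessian v x)"
    proof (rule elliptic_strict_contact[where T = T and Qc = Q0 and \<eta> = \<eta> and \<Lambda> = L and l = l and \<delta> = \<delta> and T' = T'])
      show "((\<lambda>(t, p, M). T t p M) has_derivative T' Q) (at Q within {0<..} \<times> UNIV \<times> sym_mats)"
        if "Q \<in> {0<..} \<times> UNIV \<times> sym_mats" for Q
        using T'[of Q] that unfolding X_def by blast
      show "elliptic T" by (rule ell)
      show "norm (T' Q) \<le> L \<and> T' Q (0, 0, mat 1) \<le> - l"
        if "Q \<in> {0<..} \<times> UNIV \<times> sym_mats" "dist Q Q0 < \<eta>" for Q
        using \<eta>(2)[of Q] that unfolding X_def by blast
      show "(v x, gradient v x, hessian v x) \<in> {0<..} \<times> UNIV \<times> sym_mats"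
        using JX[OF xB(2)] by (simp add: J_def X_def)
      show "dist (v x, gradient v x, hessian v x) Q0 < \<eta> / 2"
        using d1(2)[of x] xB(3) r(4) by (simp add: J_def)
      show "u x > 0" using u_gt_v[OF xB(1)] v_pos[OF xB(2)] by simp
      show "hessian u x \<in> sym_mats"
        by (rule hessian_symmetric[OF u_C2 _ xB(1)]) (simp add: open_Diff)
      show "y \<bullet> (hessian v x *v y) + 2 * \<delta> * (y \<bullet> y) \<le> y \<bullet> (hessian u x *v y)" for y
        using contact by blast
      show "\<bar>u x - v x\<bar> + norm (gradient u x - gradient v x) + 2 * \<delta> * norm (mat 1 :: real^'n^'n) < \<eta> / 2"
        using tot \<delta>\<eta> unfolding m_def by linarith
      show "L * (\<bar>u x - v x\<bar> + norm (gradient u x - gradient v x)) < 2 * \<delta> * l"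
      proof -
        have "L * (\<bar>u x - v x\<bar> + norm (gradient u x - gradient v x)) \<le> L * (5 * \<delta> * r)"
          using tot L by (intro mult_left_mono) auto
        also have "\<dots> = \<delta> * (5 * L * r)" by simp
        also have "\<dots> \<le> \<delta> * l" using rL \<delta> by (intro mult_left_mono) auto
        also have "\<dots> < 2 * \<delta> * l" using \<delta> l by simp
        finally show ?thesis .
      qed
      show "\<delta> > 0" by fact
    qed
    with T_u[OF xB(1)] T_v[OF xB(1)] show False by linarith
  qed
  then show ?thesis using \<delta> r(1) by (intro exI[of _ "\<delta> * r"] exI[of _ r] conjI ballI) auto
qed

theorem corollary1p6:
  fixes S :: "real^'n \<Rightarrow> real^'n^'n \<Rightarrow> real"
    and T :: "real \<Rightarrow> real^'n \<Rightarrow> real^'n^'n \<Rightarrow> real"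
    and u v :: "real^'n \<Rightarrow> real"
  assumes n: "CARD('n) \<ge> 2"
    and S_C1: "C1_on (\<lambda>(p, M). S p M) (UNIV \<times> sym_mats)"
    and S_ell: "\<And>p M. M \<in> sym_mats \<Longrightarrow> pos_def (- matrix_deriv (S p) M)"
    and T_C1: "C1_on (\<lambda>(t, p, M). T t p M) ({0<..} \<times> UNIV \<times> sym_mats)"
    and T_cases:
      "(\<forall>t>0. \<forall>p. \<forall>M\<in>sym_mats. T t p M = S p M)
       \<or> ((\<forall>t>0. \<forall>p. \<forall>M\<in>sym_mats. pos_def (- matrix_deriv (T t p) M)) \<and>
          (\<exists>\<epsilon>>0. \<forall>l\<in>{1 - \<epsilon><..<1 + \<epsilon>}. \<forall>t>0. \<forall>p. \<forall>M\<in>sym_mats.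
              sgn (T (l * t) (l *\<^sub>R p) (l *\<^sub>R M)) = sgn (T t p M)))
       \<or> (\<forall>t>0. \<forall>p. \<forall>M\<in>sym_mats.
              T t p M = S ((1 / (t + 1)) *\<^sub>R p) ((1 / (t + 1)) *\<^sub>R M))"
    and u_C2: "C2_on u (ball 0 2 - {0})"
    and v_C2: "C2_on v (ball 0 2)"
    and v_pos: "\<And>x. x \<in> ball 0 2 \<Longrightarrow> v x > 0"
    and u_gt_v: "\<And>x. x \<in> ball 0 2 - {0} \<Longrightarrow> u x > v x"
    and u_super: "\<And>x. x \<in> ball 0 2 - {0} \<Longrightarrow> laplacian u x \<le> 0"
    and T_u: "\<And>x. x \<in> ball 0 2 - {0} \<Longrightarrow> T (u x) (gradient u x) (hessian u x) \<ge> 0"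
    and T_v: "\<And>x. x \<in> ball 0 2 - {0} \<Longrightarrow> 0 \<ge> T (v x) (gradient v x) (hessian v x)"
  shows "Liminf (at 0) (\<lambda>x. ereal (u x - v x)) > 0"
proof -
  have ell: "elliptic T"
    by (rule elliptic_of_cases[OF S_C1 S_ell]) (use T_cases in \<open>auto simp: elliptic_def\<close>)
  obtain e r where e: "e > 0" and r: "r > 0"
    and cone: "\<And>x. x \<in> ball 0 r - {0} \<Longrightarrow> v x + e * norm x \<le> u x"
    using cone_below_solution[OF T_C1 ell _ u_C2 v_C2 v_pos u_gt_v T_u T_v] by auto
  have v0: "(v has_derivative (\<lambda>h. gradient v 0 \<bullet> h)) (at 0)"
    using v_C2 by (intro C1_on_has_derivative[of v "ball 0 2"]) (auto simp: C2_on_def)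
  have u_nonneg: "0 \<le> u x" if "x \<in> ball 0 2 - {0}" for x
    using u_gt_v[OF that] v_pos[of x] that by simp
  obtain c where c: "c > 0" "eventually (\<lambda>x. c \<le> u x - v x) (at 0)"
    using superharmonic_above_cone[OF n u_C2 u_super u_nonneg v0 _ e r cone] by auto
  have "ereal c \<le> Liminf (at 0) (\<lambda>x. ereal (u x - v x))"
    using c(2) by (intro Liminf_bounded) simp
  moreover have "0 < ereal c" using c(1) by simp
  ultimately show ?thesis by (rule less_le_trans[rotated])
qed

end
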